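(* Let $p\ge1$. Assume that $\eta$ is continuous at $0$, non-increasing, with $\eta(0)>0$; that there is $D>0$ with $\frac1D\le\rho(x)\le D$ for all $x\in\Omega$; and that there exists $q>p$ such that $\aleph_\eta^q<+\infty$. Then there exist the following. (1) An open set $\Sigma\supset\Omega$ and $\delta>0$ such that $\bigcup_{x\in\Omega}B_\delta(x)\subset\Sigma$. (2) A probability measure $\widetilde\mu$ with density $\widetilde\rho$ on $\Sigma$ such that there exists $\kappa>0$ with $\frac1\kappa\le\widetilde\rho\le\kappa$. Additionally, $\widetilde\rho|_\Omega$ is proportional to $\rho$. (3) An extension operator $\mathfrak X:L^p(\Omega;\mu)\to L^p(\Sigma;\widetilde\mu)$ such that, for any $f\in L^p(\Omega;\mu)$, $\mathfrak Xf|_\Omega=f$. Moreover, there exist constants $A>0$, $B\ge1$, $C>0$ such that, for any $\varepsilon>0$ and any $f\in L^p(\Omega;\mu)$, $$\frac1{\varepsilon^p}\mathcal F^p[\eta_\varepsilon;(\Sigma,\widetilde\mu)](\mathfrak Xf)\le A\left(\|f\|_{L^p(\Omega;\mu)}^p+\frac1{B^p\varepsilon^p}\mathcal F^p[\eta_{B\varepsilon};(\Omega,\mu)](f)\right)$$ and $$\|\mathfrak Xf\|_{L^p(\Sigma;\widetilde\mu)}\le C\|f\|_{L^p(\Omega;\mu)}.$$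
   Context: $d\in\mathbb N=\{1,2,\dots\}$; $\Omega\subset\mathbb R^d$ is open and bounded with Lipschitz boundary (near each boundary point, in suitable orthonormal coordinates, $\Omega$ is the region on one side of the graph of a Lipschitz function). $\mu$ is a probability measure on $\Omega$ with continuous density $\rho:\Omega\to\mathbb R$ with respect to Lebesgue measure. $\eta:[0,\infty)\to[0,\infty)$ is a function (the kernel), $\eta_\varepsilon(r):=\varepsilon^{-d}\eta(r/\varepsilon)$ for $\varepsilon>0$, and $\aleph_\eta^t:=\int_0^\infty\eta(r)r^{d+t-1}\,dr$ for $t\ge0$. $B_r(x)$ is the open ball of radius $r$ centred at $x$. Densities are with respect to Lebesgue measure. For $J:[0,\infty)\to[0,\infty)$, an open set $U\subset\mathbb R^d$ with probability measure $\nu$ of density $\sigma$, and $u\in L^p(U;\nu)$, the nonlocal variation is $$\mathcal F^p[J;(U,\nu)](u):=\int_U\int_UJ(|x-y|)|u(x)-u(y)|^p\sigma(x)\sigma(y)\,dx\,dy.$$ *)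

theory Defs
  imports "HOL-Probability.Probability"
begin

text \<open>
  The Lipschitz graph is written without coordinates: the unit vector \<open>v\<close> is the last axis of the
  orthonormal frame, the hyperplane orthogonal to \<open>v\<close> plays the role of the first \<open>d - 1\<close>
  coordinates, and \<open>y - (y \<bullet> v) *\<^sub>R v\<close> is the projection of \<open>y\<close> to it.
\<close>
definition lipschitz_boundary :: "(real ^ 'n) set \<Rightarrow> bool" where
  "lipschitz_boundary \<Omega> \<longleftrightarrow>
    (\<forall>x\<^sub>0\<in>frontier \<Omega>. \<exists>v r L. \<exists>g :: real ^ 'n \<Rightarrow> real.
       norm v = 1 \<and> r > 0 \<and> L-lipschitz_on {z. z \<bullet> v = 0} g \<and>
       \<Omega> \<inter> ball x\<^sub>0 r = {y \<in> ball x\<^sub>0 r. y \<bullet> v > g (y - (y \<bullet> v) *\<^sub>R v)})"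

text \<open>
  A probability measure \<open>\<nu>\<close> whose underlying space is \<open>U\<close> (with the Borel sets of \<open>U\<close>) and whose
  density with respect to Lebesgue measure is \<open>\<sigma>\<close>; the values of \<open>\<sigma>\<close> outside \<open>U\<close> are irrelevant.
\<close>
definition prob_with_density ::
    "(real ^ 'n) set \<Rightarrow> (real ^ 'n) measure \<Rightarrow> (real ^ 'n \<Rightarrow> real) \<Rightarrow> bool" where
  "prob_with_density U \<nu> \<sigma> \<longleftrightarrow>
     prob_space \<nu> \<and>
     \<sigma> \<in> borel_measurable (restrict_space lborel U) \<and>
     (\<forall>x\<in>U. 0 \<le> \<sigma> x) \<and>
     \<nu> = density (restrict_space lborel U) (\<lambda>x. ennreal (\<sigma> x))"

text \<open>
  Elements of \<open>Lp p \<nu>\<close> are representatives; identification up to null sets is made explicit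
  wherever it matters.
\<close>
definition Lp :: "real \<Rightarrow> 'a measure \<Rightarrow> ('a \<Rightarrow> real) set" where
  "Lp p \<nu> = {f \<in> borel_measurable \<nu>. integrable \<nu> (\<lambda>x. \<bar>f x\<bar> powr p)}"

definition Lp_norm :: "real \<Rightarrow> 'a measure \<Rightarrow> ('a \<Rightarrow> real) \<Rightarrow> real" where
  "Lp_norm p \<nu> f = (\<integral>x. \<bar>f x\<bar> powr p \<partial>\<nu>) powr (1 / p)"

definition scaled_kernel :: "nat \<Rightarrow> (real \<Rightarrow> real) \<Rightarrow> real \<Rightarrow> real \<Rightarrow> real" where
  "scaled_kernel d \<eta> \<epsilon> r = \<eta> (r / \<epsilon>) / \<epsilon> ^ d"

definition kernel_moment :: "nat \<Rightarrow> (real \<Rightarrow> real) \<Rightarrow> real \<Rightarrow> ennreal" where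
  "kernel_moment d \<eta> t = (\<integral>\<^sup>+ r\<in>{0..}. ennreal (\<eta> r * r powr (real d + t - 1)) \<partial>lborel)"

text \<open>The measure enters only through its density \<open>\<sigma>\<close> on \<open>U\<close>; the value may be infinite.\<close>
definition nonlocal_variation ::
    "real \<Rightarrow> (real \<Rightarrow> real) \<Rightarrow> (real ^ 'n) set \<Rightarrow> (real ^ 'n \<Rightarrow> real) \<Rightarrow> (real ^ 'n \<Rightarrow> real) \<Rightarrow> ennreal"
  where
  "nonlocal_variation p J U \<sigma> u =
     (\<integral>\<^sup>+ x\<in>U. (\<integral>\<^sup>+ y\<in>U. ennreal (J (norm (x - y)) * \<bar>u x - u y\<bar> powr p * \<sigma> x * \<sigma> y) \<partial>lborel) \<partial>lborel)"

text \<open>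
  A linear operator between the Lebesgue spaces of \<open>\<mu>\<close> and \<open>\<mu>'\<close>, given on representatives: the
  second condition says that it descends to equivalence classes. It is an extension operator if the
  restriction of \<open>X f\<close> to the space of \<open>\<mu>\<close> is \<open>f\<close> as an element of the Lebesgue space of \<open>\<mu>\<close>.
\<close>
definition Lp_extension_operator ::
    "real \<Rightarrow> 'a measure \<Rightarrow> 'a measure \<Rightarrow> (('a \<Rightarrow> real) \<Rightarrow> 'a \<Rightarrow> real) \<Rightarrow> bool" where
  "Lp_extension_operator p \<mu> \<mu>' X \<longleftrightarrow>
     (\<forall>f\<in>Lp p \<mu>. X f \<in> Lp p \<mu>') \<and>
     (\<forall>f\<in>Lp p \<mu>. \<forall>g\<in>Lp p \<mu>. (AE x in \<mu>. f x = g x) \<longrightarrow> (AE x in \<mu>'. X f x = X g x)) \<and>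
     (\<forall>f\<in>Lp p \<mu>. \<forall>g\<in>Lp p \<mu>. AE x in \<mu>'. X (\<lambda>y. f y + g y) x = X f x + X g x) \<and>
     (\<forall>f\<in>Lp p \<mu>. \<forall>c. AE x in \<mu>'. X (\<lambda>y. c * f y) x = c * X f x) \<and>
     (\<forall>f\<in>Lp p \<mu>. AE x in \<mu>. X f x = f x)"

end

theory Submission
  imports Defs
begin

text \<open>
  The extension is built from local reflections. Near a boundary point, \<open>\<Omega>\<close> lies above a Lipschitz
  graph in a direction \<open>v\<close>; let \<open>T\<close> reflect the points below the graph vertically to points above it
  and fix the points above. Two properties of this fold make \<open>f \<circ> T\<close> a good local extension. It is
  Lipschitz, with a constant \<open>K\<close> say, so that \<open>\<eta> (\<bar>x - y\<bar> / \<epsilon>) \<le> \<eta> (\<bar>T x - T y\<bar> / (K * \<epsilon>))\<close> because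
  the kernel decreases; this is where the larger scale \<open>B * \<epsilon>\<close> comes from. And it covers every point
  above the graph exactly twice, each time preserving volume, so that substituting \<open>T\<close> in both
  variables costs at most a factor four (\<open>lipschitz_fold_into_domain\<close>).

  Finitely many of these local extensions are glued with Lipschitz cutoffs. The increments of
  \<open>\<psi> * u\<close> exceed those of \<open>u\<close> by at most \<open>\<Lambda> * \<bar>x - y\<bar> * \<bar>u\<bar>\<close>, and
  \<open>\<epsilon>\<^sup>-\<^sup>p \<integral> \<eta>\<^sub>\<epsilon> (\<bar>x - y\<bar>) * \<bar>x - y\<bar>\<^sup>p dy\<close> does not depend on \<open>\<epsilon>\<close>: it is the \<open>p\<close>-th moment of the kernel, up
  to a dimensional constant. So a cutoff only adds a multiple of the \<open>L\<^sup>p\<close> norm, uniformly in \<open>\<epsilon>\<close>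
  (\<open>energy_multiplier_le\<close>). As this holds on the whole space and not only on a neighbourhood of
  \<open>\<Omega>\<close>, the glued function is defined and controlled everywhere, and \<open>\<Sigma>\<close> can be any
  ball that is large enough.

  That the moment is finite follows from the assumption on \<open>q\<close>: a decreasing kernel with finite
  moment of order \<open>q\<close> is bounded by a multiple of \<open>s\<^sup>-\<^sup>(\<^sup>d\<^sup>+\<^sup>q\<^sup>)\<close>, and then dyadic shells form a geometric
  series with ratio \<open>2\<^sup>p\<^sup>-\<^sup>q\<close> (\<open>radial_moment_finite\<close>).

  The estimates are proved for Lebesgue measure. Densities between two positive constants change
  all quantities by bounded factors only, which is how the two measures enter at the end.
\<close>

section \<open>Folding along a Lipschitz graph\<close>

lemma nn_integral_lborel_affine:
  fixes F :: "'a::euclidean_space \<Rightarrow> ennreal"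
  assumes [measurable]: "F \<in> borel_measurable borel" and "c \<noteq> 0"
  shows "(\<integral>\<^sup>+x. F x \<partial>lborel) = ennreal (\<bar>c\<bar> ^ DIM('a)) * (\<integral>\<^sup>+x. F (t + c *\<^sub>R x) \<partial>lborel)"
proof -
  have "(\<integral>\<^sup>+x. F x \<partial>lborel)
      = (\<integral>\<^sup>+x. F x \<partial>density (distr lborel borel (\<lambda>x. t + c *\<^sub>R x)) (\<lambda>_. ennreal (\<bar>c\<bar> ^ DIM('a))))"
    by (rule arg_cong[where f = "\<lambda>M. \<integral>\<^sup>+x. F x \<partial>M"]) (rule lborel_affine[OF \<open>c \<noteq> 0\<close>])
  then show ?thesis
    by (simp add: nn_integral_density nn_integral_distr nn_integral_cmult)
qed

text \<open>
  Fubini along an arbitrary direction without choosing coordinates: the slab \<open>0 \<le> y \<bullet> v \<le> 1\<close> meets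
  each line parallel to \<open>v\<close> in a segment of length one, so averaging the line integrals over the slab
  counts every line once. The proof exchanges the integrals and translates by \<open>s *\<^sub>R v\<close>.
\<close>
lemma nn_integral_slices:
  fixes v :: "'a::euclidean_space" and F :: "'a \<Rightarrow> ennreal"
  assumes [measurable]: "F \<in> borel_measurable borel" and v: "norm v = 1"
  shows "(\<integral>\<^sup>+y. F y \<partial>lborel) =
    (\<integral>\<^sup>+y. indicator {0..1} (y \<bullet> v) * (\<integral>\<^sup>+s. F (y + s *\<^sub>R v) \<partial>lborel) \<partial>lborel)"
proof -
  have vv: "v \<bullet> v = 1" using v by (simp add: dot_square_norm)
  have "(\<integral>\<^sup>+y. indicator {0..1} (y \<bullet> v) * (\<integral>\<^sup>+s. F (y + s *\<^sub>R v) \<partial>lborel) \<partial>lborel)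
      = (\<integral>\<^sup>+y. \<integral>\<^sup>+s. indicator {0..1} (y \<bullet> v) * F (y + s *\<^sub>R v) \<partial>lborel \<partial>lborel)"
    by (simp add: nn_integral_cmult)
  also have "\<dots> = (\<integral>\<^sup>+s. \<integral>\<^sup>+y. indicator {0..1} (y \<bullet> v) * F (y + s *\<^sub>R v) \<partial>lborel \<partial>(lborel::real measure))"
    by (rule lborel_pair.Fubini') measurable
  also have "\<dots> = (\<integral>\<^sup>+s. \<integral>\<^sup>+y. indicator {0..1} (y \<bullet> v - s) * F y \<partial>lborel \<partial>(lborel::real measure))"
  proof (rule nn_integral_cong)
    fix s :: real
    show "(\<integral>\<^sup>+y. indicator {0..1} (y \<bullet> v) * F (y + s *\<^sub>R v) \<partial>lborel)
        = (\<integral>\<^sup>+y. indicator {0..1} (y \<bullet> v - s) * F y \<partial>lborel)"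
      by (subst (2) nn_integral_lborel_affine[where c = 1 and t = "s *\<^sub>R v"])
        (simp_all add: inner_add_left vv add.commute)
  qed
  also have "\<dots> = (\<integral>\<^sup>+y. \<integral>\<^sup>+s. indicator {0..1} (y \<bullet> v - s) * F y \<partial>(lborel::real measure) \<partial>lborel)"
    by (rule lborel_pair.Fubini') measurable
  also have "\<dots> = (\<integral>\<^sup>+y. F y \<partial>lborel)"
  proof (rule nn_integral_cong)
    fix y :: 'a
    have "(\<integral>\<^sup>+s. indicator {0..1} (y \<bullet> v - s) * F y \<partial>(lborel::real measure))
        = (\<integral>\<^sup>+s. F y * indicator {y \<bullet> v - 1..y \<bullet> v} s \<partial>(lborel::real measure))"
      by (intro nn_integral_cong) (auto simp: indicator_def)
    then show "(\<integral>\<^sup>+s. indicator {0..1} (y \<bullet> v - s) * F y \<partial>(lborel::real measure)) = F y"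
      by (simp add: nn_integral_cmult)
  qed
  finally show ?thesis by simp
qed

text \<open>
  The map \<open>s \<mapsto> s + 2 * max 0 (a - s)\<close> folds the half-line below \<open>a\<close> onto the one above it.
\<close>
lemma nn_integral_fold_line:
  fixes k :: "real \<Rightarrow> ennreal"
  assumes [measurable]: "k \<in> borel_measurable borel"
  shows "(\<integral>\<^sup>+s. k (s + 2 * max 0 (a - s)) \<partial>lborel) = 2 * (\<integral>\<^sup>+s. k s * indicator {a<..} s \<partial>lborel)"
proof -
  have "AE s in lborel. s \<noteq> a"
    by (rule AE_lborel_singleton)
  then have "(\<integral>\<^sup>+s. k (s + 2 * max 0 (a - s)) \<partial>lborel)
      = (\<integral>\<^sup>+s. k s * indicator {a<..} s + k (2 * a - s) * indicator {..<a} s \<partial>lborel)"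
    by (intro nn_integral_cong_AE, eventually_elim)
      (auto simp: indicator_def max_def algebra_simps split: if_splits)
  also have "\<dots> = (\<integral>\<^sup>+s. k s * indicator {a<..} s \<partial>lborel)
      + (\<integral>\<^sup>+s. k (2 * a - s) * indicator {..<a} s \<partial>lborel)"
    by (rule nn_integral_add) auto
  also have "(\<integral>\<^sup>+s. k (2 * a - s) * indicator {..<a} s \<partial>lborel)
      = (\<integral>\<^sup>+s. k s * indicator {a<..} s \<partial>lborel)"
    by (subst (2) nn_integral_real_affine[where c = "-1" and t = "2 * a"])
      (auto intro!: nn_integral_cong simp: indicator_def)
  finally show ?thesis unfolding mult_2[of "\<integral>\<^sup>+s. k s * indicator {a<..} s \<partial>lborel"] .
qed

text \<open>
  Here \<open>h y\<close> is the signed height of the graph above \<open>y\<close> in direction \<open>v\<close>, so that the argument of \<open>F\<close>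
  is the vertical reflection of points below the graph. On each line parallel to \<open>v\<close> it is the
  one-dimensional fold.
\<close>
lemma nn_integral_fold:
  fixes v :: "'a::euclidean_space" and F :: "'a \<Rightarrow> ennreal" and h :: "'a \<Rightarrow> real"
  assumes [measurable]: "F \<in> borel_measurable borel" "h \<in> borel_measurable borel"
    and v: "norm v = 1" and h: "\<And>y s. h (y + s *\<^sub>R v) = h y - s"
  shows "(\<integral>\<^sup>+y. F (y + (2 * max 0 (h y)) *\<^sub>R v) \<partial>lborel)
    = 2 * (\<integral>\<^sup>+y. F y * indicator {y. h y < 0} y \<partial>lborel)"
proof -
  have eq: "(\<integral>\<^sup>+s. F (y + s *\<^sub>R v + (2 * max 0 (h (y + s *\<^sub>R v))) *\<^sub>R v) \<partial>lborel)
      = 2 * (\<integral>\<^sup>+s. F (y + s *\<^sub>R v) * indicator {y. h y < 0} (y + s *\<^sub>R v) \<partial>lborel)" for y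
    using nn_integral_fold_line[of "\<lambda>s. F (y + s *\<^sub>R v)" "h y"]
    by (simp add: h algebra_simps indicator_def)
  have "(\<integral>\<^sup>+y. F (y + (2 * max 0 (h y)) *\<^sub>R v) \<partial>lborel)
      = (\<integral>\<^sup>+y. indicator {0..1} (y \<bullet> v) *
          (\<integral>\<^sup>+s. F (y + s *\<^sub>R v + (2 * max 0 (h (y + s *\<^sub>R v))) *\<^sub>R v) \<partial>lborel) \<partial>lborel)"
    by (rule nn_integral_slices[OF _ v]) measurable
  also have "\<dots> = 2 * (\<integral>\<^sup>+y. indicator {0..1} (y \<bullet> v) *
          (\<integral>\<^sup>+s. F (y + s *\<^sub>R v) * indicator {y. h y < 0} (y + s *\<^sub>R v) \<partial>lborel) \<partial>lborel)"
    unfolding eq by (subst nn_integral_cmult[symmetric]) (auto simp: ac_simps)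
  also have "\<dots> = 2 * (\<integral>\<^sup>+y. F y * indicator {y. h y < 0} y \<partial>lborel)"
    by (subst nn_integral_slices[OF _ v, of "\<lambda>y. F y * indicator {y. h y < 0} y"]) auto
  finally show ?thesis .
qed

text \<open>
  At interior points the identity is a fold. At a boundary point \<open>x0\<close>, which lies on the graph and is
  therefore fixed by \<open>T\<close>, the Lipschitz bound keeps the image of a ball of radius \<open>s = r / K\<close> inside
  the ball of radius \<open>r\<close> in which \<open>\<Omega>\<close> is known to be the region above the graph.
\<close>
lemma lipschitz_fold_into_domain:
  fixes \<Omega> :: "(real ^ 'n) set"
  assumes op: "open \<Omega>" and lip: "lipschitz_boundary \<Omega>" and x0: "x0 \<in> closure \<Omega>"
  obtains s K T where "s > 0" "K \<ge> 1" "T \<in> borel_measurable borel"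
    "\<And>x y. dist (T x) (T y) \<le> K * dist x y"
    "\<And>x. x \<in> \<Omega> \<inter> ball x0 s \<Longrightarrow> T x = x"
    "\<And>F. F \<in> borel_measurable borel \<Longrightarrow>
       (\<integral>\<^sup>+x\<in>ball x0 s. F (T x) \<partial>lborel) \<le> 2 * (\<integral>\<^sup>+x\<in>\<Omega>. F x \<partial>lborel)"
proof (cases "x0 \<in> \<Omega>")
  case True
  then obtain s where s: "s > 0" "ball x0 s \<subseteq> \<Omega>"
    using op open_contains_ball by blast
  show ?thesis
  proof (rule that[of s 1 "\<lambda>x. x"])
    fix F :: "real ^ 'n \<Rightarrow> ennreal"
    have "(\<integral>\<^sup>+x\<in>ball x0 s. F x \<partial>lborel) \<le> (\<integral>\<^sup>+x\<in>\<Omega>. F x \<partial>lborel)"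
      using s by (intro nn_integral_mono) (auto simp: indicator_def)
    then show "(\<integral>\<^sup>+x\<in>ball x0 s. F x \<partial>lborel) \<le> 2 * (\<integral>\<^sup>+x\<in>\<Omega>. F x \<partial>lborel)"
      by (auto simp: mult_2 intro: add_increasing)
  qed (use s in auto)
next
  case False
  then have fr: "x0 \<in> frontier \<Omega>"
    using x0 op by (simp add: frontier_def interior_open)
  have "\<exists>v r L. \<exists>g :: real ^ 'n \<Rightarrow> real.
       norm v = 1 \<and> r > 0 \<and> L-lipschitz_on {z. z \<bullet> v = 0} g \<and>
       \<Omega> \<inter> ball x0 r = {y \<in> ball x0 r. y \<bullet> v > g (y - (y \<bullet> v) *\<^sub>R v)}"
    using lip fr unfolding lipschitz_boundary_def by (rule bspec)
  then obtain v r L g where v: "norm v = 1" and r: "r > 0" and g: "L-lipschitz_on {z. z \<bullet> v = 0} g"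
    and eq: "\<Omega> \<inter> ball x0 r = {y \<in> ball x0 r. y \<bullet> v > g (y - (y \<bullet> v) *\<^sub>R v)}"
    by (elim exE conjE) (rule that)
  have vv: "v \<bullet> v = 1" using v by (simp add: dot_square_norm)
  define P where "P y = y - (y \<bullet> v) *\<^sub>R v" for y :: "real ^ 'n"
  define h where "h y = g (P y) - y \<bullet> v" for y
  define T where "T y = y + (2 * max 0 (h y)) *\<^sub>R v" for y
  have L: "L \<ge> 0" using g by (rule lipschitz_on_nonneg)
  have inner_le: "\<bar>x \<bullet> v - y \<bullet> v\<bar> \<le> dist x y" for x y
    using Cauchy_Schwarz_ineq2[of "x - y" v] v by (simp add: inner_diff_left dist_norm)
  have P_dist: "dist (P x) (P y) \<le> 2 * dist x y" for x y
  proof -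
    have "P x - P y = (x - y) - (x \<bullet> v - y \<bullet> v) *\<^sub>R v"
      by (simp add: P_def algebra_simps)
    then have "dist (P x) (P y) \<le> norm (x - y) + norm ((x \<bullet> v - y \<bullet> v) *\<^sub>R v)"
      by (metis dist_norm norm_triangle_ineq4)
    also have "\<dots> \<le> 2 * dist x y"
      using inner_le[of x y] v by (simp add: dist_norm)
    finally show ?thesis .
  qed
  have Pv: "P y \<bullet> v = 0" for y by (simp add: P_def inner_diff_left vv)
  have h_lip: "\<bar>h x - h y\<bar> \<le> (2 * L + 1) * dist x y" for x y
  proof -
    have "\<bar>g (P x) - g (P y)\<bar> \<le> L * dist (P x) (P y)"
      using lipschitz_onD[OF g, of "P x" "P y"] Pv by (simp add: dist_real_def)
    also have "\<dots> \<le> L * (2 * dist x y)"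
      using P_dist L by (intro mult_left_mono) auto
    finally show ?thesis
      using inner_le[of x y] by (simp add: h_def algebra_simps)
  qed
  have h_shift: "h (y + s *\<^sub>R v) = h y - s" for y s
    by (simp add: h_def P_def inner_add_left vv algebra_simps)
  have "(2 * L + 1)-lipschitz_on UNIV h"
    using h_lip L by (auto simp: lipschitz_on_def dist_real_def)
  then have h_cont: "continuous_on UNIV h" by (rule lipschitz_on_continuous_on)
  then have [measurable]: "h \<in> borel_measurable borel"
    by (rule borel_measurable_continuous_onI)
  \<comment> \<open>The fold moves \<open>y\<close> by \<open>2 * max 0 (h y)\<close>, and \<open>h\<close> has Lipschitz constant \<open>2 * L + 1\<close>.\<close>
  define K where "K = 3 + 4 * L"
  have K: "K \<ge> 1" using L by (simp add: K_def)
  have scale: "norm ((2 * t) *\<^sub>R v) = 2 * \<bar>t\<bar>" for t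
    using v by (simp add: abs_mult)
  have T_lip: "dist (T x) (T y) \<le> K * dist x y" for x y
  proof -
    have "T x - T y = (x - y) + (2 * (max 0 (h x) - max 0 (h y))) *\<^sub>R v"
      by (simp add: T_def algebra_simps)
    then have "dist (T x) (T y) \<le> norm (x - y) + norm ((2 * (max 0 (h x) - max 0 (h y))) *\<^sub>R v)"
      unfolding dist_norm by (simp only: norm_triangle_ineq)
    also have "\<dots> \<le> dist x y + 2 * \<bar>h x - h y\<bar>"
    proof -
      have "\<bar>max 0 (h x) - max 0 (h y)\<bar> \<le> \<bar>h x - h y\<bar>"
        by (auto simp: max_def)
      then have "2 * \<bar>max 0 (h x) - max 0 (h y)\<bar> \<le> 2 * \<bar>h x - h y\<bar>"
        by (rule mult_left_mono) simp
      then show ?thesis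
        unfolding dist_norm scale by (rule add_left_mono)
    qed
    also have "\<dots> \<le> K * dist x y"
      using h_lip[of x y] by (simp add: K_def algebra_simps)
    finally show ?thesis .
  qed
  have [measurable]: "T \<in> borel_measurable borel"
    unfolding T_def by measurable
  have above: "y \<in> \<Omega> \<longleftrightarrow> h y < 0" if "y \<in> ball x0 r" for y
  proof -
    have "y \<in> \<Omega> \<longleftrightarrow> y \<in> {y \<in> ball x0 r. y \<bullet> v > g (y - (y \<bullet> v) *\<^sub>R v)}"
      using that unfolding eq[symmetric] by simp
    also have "\<dots> \<longleftrightarrow> h y < 0"
      using that by (simp add: h_def P_def)
    finally show ?thesis .
  qed
  \<comment> \<open>A point strictly below the graph has a neighbourhood that misses \<open>\<Omega>\<close>,
    and a point strictly above belongs to \<open>\<Omega>\<close>.\<close>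
  have "h x0 = 0"
  proof (rule ccontr)
    assume "h x0 \<noteq> 0"
    then have "h x0 > 0" using above[of x0] False r by simp
    then have "open (ball x0 r \<inter> {y. h y > 0})" "x0 \<in> ball x0 r \<inter> {y. h y > 0}"
      using r open_Collect_less[OF continuous_on_const h_cont, of 0] by auto
    moreover have "\<Omega> \<inter> (ball x0 r \<inter> {y. h y > 0}) = {}"
      using above by force
    moreover have "\<Omega> \<inter> S \<noteq> {}" if "open S" "x0 \<in> S" for S
      using x0 that by (auto simp: closure_iff_nhds_not_empty)
    ultimately show False by blast
  qed
  then have T0: "T x0 = x0" by (simp add: T_def)
  define s where "s = r / K"
  have s: "s > 0" "s \<le> r"
    using r K by (auto simp: s_def field_simps)
  have T_ball: "T x \<in> ball x0 r" if "x \<in> ball x0 s" for x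
  proof -
    have "dist x0 (T x) \<le> K * dist x0 x" using T_lip[of x0 x] T0 by simp
    also have "\<dots> < K * s" using that K by (intro mult_strict_left_mono) auto
    finally show ?thesis using K by (simp add: s_def)
  qed
  show ?thesis
  proof (rule that[of s K T])
    fix x assume "x \<in> \<Omega> \<inter> ball x0 s"
    then have "h x < 0" using above[of x] s by auto
    then show "T x = x" by (simp add: T_def)
  next
    fix F :: "real ^ 'n \<Rightarrow> ennreal" assume [measurable]: "F \<in> borel_measurable borel"
    have "(\<integral>\<^sup>+x\<in>ball x0 s. F (T x) \<partial>lborel)
        \<le> (\<integral>\<^sup>+x. F (T x) * indicator (ball x0 r) (T x) \<partial>lborel)"
      using T_ball by (intro nn_integral_mono) (auto simp: indicator_def)
    also have "\<dots> = 2 * (\<integral>\<^sup>+y. F y * indicator (ball x0 r) y * indicator {y. h y < 0} y \<partial>lborel)"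
    proof -
      have [measurable]: "ball x0 r \<in> sets borel" by simp
      have "(\<lambda>y. F y * indicator (ball x0 r) y) \<in> borel_measurable borel"
        by measurable
      from nn_integral_fold[OF this _ v h_shift] show ?thesis
        unfolding T_def by simp
    qed
    also have "\<dots> \<le> 2 * (\<integral>\<^sup>+x\<in>\<Omega>. F x \<partial>lborel)"
      using above by (intro mult_left_mono nn_integral_mono) (auto simp: indicator_def)
    finally show "(\<integral>\<^sup>+x\<in>ball x0 s. F (T x) \<partial>lborel) \<le> 2 * (\<integral>\<^sup>+x\<in>\<Omega>. F x \<partial>lborel)" .
  qed (use s K T_lip in auto)
qed

section \<open>Moments of decreasing radial kernels\<close>

text \<open>
  On \<open>[s/2, s]\<close> the integrand of the moment is at least \<open>\<eta> s * (s/2)\<^bsup>d+q-1\<^esup>\<close>.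
\<close>
lemma antimono_kernel_decay:
  fixes \<eta> :: "real \<Rightarrow> real"
  assumes nn: "\<And>t. 0 \<le> \<eta> t" and anti: "antimono \<eta>" and q: "real d + q \<ge> 1"
    and fin: "kernel_moment d \<eta> q < \<infinity>"
  obtains C where "C \<ge> 0" "\<And>s. s > 0 \<Longrightarrow> \<eta> s \<le> C * s powr - (real d + q)"
proof
  define e where "e = real d + q"
  define C where "C = 2 powr e * enn2real (kernel_moment d \<eta> q)"
  show "C \<ge> 0" by (simp add: C_def)
  fix s :: real assume s: "s > 0"
  define c where "c = \<eta> s * (s / 2) powr (e - 1)"
  have c: "c \<ge> 0" using nn by (simp add: c_def)
  have "ennreal (c * (s / 2)) = (\<integral>\<^sup>+r. ennreal c * indicator {s / 2..s} r \<partial>lborel)"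
    using s c by (subst nn_integral_cmult_indicator) (auto simp flip: ennreal_mult)
  also have "\<dots> \<le> kernel_moment d \<eta> q"
    unfolding kernel_moment_def
  proof (rule nn_integral_mono)
    fix r :: real
    show "ennreal c * indicator {s / 2..s} r
        \<le> ennreal (\<eta> r * r powr (real d + q - 1)) * indicator {0..} r"
    proof (cases "r \<in> {s / 2..s}")
      case True
      have "c \<le> \<eta> r * r powr (e - 1)"
        unfolding c_def using True s q nn by (intro mult_mono antimonoD[OF anti] powr_mono2) (auto simp: e_def)
      then show ?thesis using True s by (simp add: e_def ennreal_leI)
    qed simp
  qed
  finally have "enn2real (ennreal (c * (s / 2))) \<le> enn2real (kernel_moment d \<eta> q)"
    using fin by (intro enn2real_mono) auto
  then have "\<eta> s * ((s / 2) powr (e - 1) * (s / 2)) \<le> enn2real (kernel_moment d \<eta> q)"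
    unfolding enn2real_ennreal[OF mult_nonneg_nonneg[OF c less_imp_le[OF half_gt_zero[OF s]]]]
    by (simp add: c_def mult.assoc)
  moreover have "(s / 2) powr (e - 1) * (s / 2) = s powr e / 2 powr e"
    using s by (simp add: powr_diff powr_divide field_simps)
  ultimately have "\<eta> s * (s powr e / 2 powr e) \<le> enn2real (kernel_moment d \<eta> q)"
    by (simp only:)
  then have "\<eta> s * s powr e \<le> C"
    by (simp add: C_def field_simps)
  then show "\<eta> s \<le> C * s powr - (real d + q)"
    using s unfolding e_def[symmetric] by (simp add: powr_minus field_simps)
qed

lemma dyadic_bracket:
  fixes x :: real
  assumes "x \<ge> 1"
  obtains k :: nat where "2 ^ k \<le> x" "x < 2 ^ Suc k"
proof -
  obtain n where n: "x < 2 ^ n" using real_arch_pow[of 2 x] by auto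
  define m where "m = (LEAST n. x < 2 ^ n)"
  have m: "x < 2 ^ m" unfolding m_def using n by (rule LeastI)
  then obtain k where k: "m = Suc k" using assms by (cases m) auto
  have "\<not> x < 2 ^ k" using not_less_Least[of k "\<lambda>n. x < 2 ^ n"] k unfolding m_def by simp
  then show ?thesis using that[of k] m k by simp
qed

text \<open>
  On the shell \<open>2\<^bsup>k\<^esup> \<le> \<bar>z\<bar> < 2\<^bsup>k+1\<^esup>\<close> the integrand is at most a multiple of \<open>2\<^bsup>k(p-d-q)\<^esup>\<close>, and the volume
  of the shell is at most a multiple of \<open>2\<^bsup>kd\<^esup>\<close>.
\<close>
lemma radial_moment_finite:
  fixes \<eta> :: "real \<Rightarrow> real"
  assumes nn: "\<And>t. 0 \<le> \<eta> t" and anti: "antimono \<eta>" and p: "p \<ge> 1" and pq: "p < q"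
    and fin: "kernel_moment DIM('a::euclidean_space) \<eta> q < \<infinity>"
  shows "(\<integral>\<^sup>+z. ennreal (\<eta> (norm z) * norm z powr p) \<partial>(lborel :: 'a measure)) < \<infinity>"
proof -
  have [measurable]: "ball (0 :: 'a) r \<in> sets borel" for r
    by simp
  define d where "d = DIM('a)"
  have q: "real d + q \<ge> 1" using p pq by simp
  obtain C where C: "C \<ge> 0" "\<And>s. s > 0 \<Longrightarrow> \<eta> s \<le> C * s powr - (real d + q)"
    using antimono_kernel_decay[OF nn anti q] fin unfolding d_def by blast
  define V where "V = unit_ball_vol (real d)"
  have V: "V \<ge> 0" by (simp add: V_def)
  define a where "a k = C * (2 ^ k) powr (p - real d - q)" for k :: nat
  have a: "a k \<ge> 0" for k using C by (simp add: a_def)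
  have bound: "ennreal (\<eta> (norm z) * norm z powr p)
      \<le> ennreal (\<eta> 0) * indicator (ball 0 1) z + (\<Sum>k. ennreal (a k) * indicator (ball 0 (2 ^ Suc k)) z)" for z :: 'a
  proof (cases "norm z < 1")
    case True
    have "\<eta> (norm z) * norm z powr p \<le> \<eta> 0 * 1"
      using True p nn by (intro mult_mono antimonoD[OF anti] powr_le1) auto
    then show ?thesis using True by (auto intro!: add_increasing2 ennreal_leI)
  next
    case False
    then obtain k where k: "2 ^ k \<le> norm z" "norm z < 2 ^ Suc k"
      using dyadic_bracket[of "norm z"] by auto
    have z: "norm z > 0" using False by linarith
    have "\<eta> (norm z) * norm z powr p \<le> C * norm z powr - (real d + q) * norm z powr p"
      using C(2)[OF z] by (intro mult_right_mono) auto
    also have "\<dots> = C * norm z powr (p - real d - q)"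
      by (simp add: powr_add[symmetric] algebra_simps)
    also have "\<dots> \<le> a k"
      unfolding a_def using k C pq by (intro mult_left_mono powr_mono2') auto
    finally have "ennreal (\<eta> (norm z) * norm z powr p) \<le> ennreal (a k) * indicator (ball 0 (2 ^ Suc k)) z"
      using k by (simp add: ennreal_leI)
    also have "\<dots> \<le> (\<Sum>k. ennreal (a k) * indicator (ball 0 (2 ^ Suc k)) z)"
    proof -
      define b :: "nat \<Rightarrow> ennreal" where
        "b = (\<lambda>k. ennreal (a k) * indicator (ball 0 (2 ^ Suc k)) z)"
      have "sum b {k} \<le> suminf b" by (rule sum_le_suminf) auto
      then have "b k \<le> suminf b" by simp
      then show ?thesis unfolding b_def .
    qed
    finally show ?thesis by (auto intro: add_increasing)
  qed
  have "(\<integral>\<^sup>+z. ennreal (\<eta> (norm z) * norm z powr p) \<partial>(lborel :: 'a measure))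
      \<le> (\<integral>\<^sup>+z. ennreal (\<eta> 0) * indicator (ball 0 1) z
            + (\<Sum>k. ennreal (a k) * indicator (ball 0 (2 ^ Suc k)) z) \<partial>(lborel :: 'a measure))"
    by (intro nn_integral_mono bound)
  also have "\<dots> = ennreal (\<eta> 0) * emeasure lborel (ball 0 1 :: 'a set)
      + (\<Sum>k. ennreal (a k) * emeasure lborel (ball 0 (2 ^ Suc k) :: 'a set))"
    by (simp add: nn_integral_add nn_integral_suminf nn_integral_cmult)
  also have "(\<Sum>k. ennreal (a k) * emeasure lborel (ball 0 (2 ^ Suc k) :: 'a set))
      = (\<Sum>k. ennreal (C * V * 2 ^ d * (2 powr (p - q)) ^ k))"
  proof (rule suminf_cong)
    fix k :: nat
    have "(2 ^ k) powr (p - real d - q) * (2 ^ k) ^ d = (2 powr (p - q)) ^ k"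
      by (simp add: powr_realpow[symmetric] powr_powr powr_add[symmetric] algebra_simps)
    then have "a k * (V * (2 ^ Suc k) ^ d) = C * V * 2 ^ d * (2 powr (p - q)) ^ k"
      by (simp add: a_def power_mult_distrib mult.assoc mult.left_commute)
    moreover have "ennreal (a k) * emeasure lborel (ball 0 (2 ^ Suc k) :: 'a set)
        = ennreal (a k * (V * (2 ^ Suc k) ^ d))"
      using a V by (subst emeasure_ball) (auto simp: V_def d_def ennreal_mult'[symmetric])
    ultimately show "ennreal (a k) * emeasure lborel (ball 0 (2 ^ Suc k) :: 'a set)
        = ennreal (C * V * 2 ^ d * (2 powr (p - q)) ^ k)" by (simp only:)
  qed
  also have "\<dots> = ennreal (\<Sum>k. C * V * 2 ^ d * (2 powr (p - q)) ^ k)"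
  proof (rule suminf_ennreal2)
    have "2 powr (p - q) < 2 powr (0 :: real)"
      using pq by (intro powr_less_mono) auto
    then show "summable (\<lambda>k. C * V * 2 ^ d * (2 powr (p - q)) ^ k)"
      by (intro summable_mult summable_geometric) simp
  qed (use C V in simp)
  also have "ennreal (\<eta> 0) * emeasure lborel (ball 0 1 :: 'a set) + \<dots> < \<infinity>"
    using emeasure_lborel_ball_finite[of "0 :: 'a" 1] by (simp add: ennreal_mult_less_top)
  finally show ?thesis .
qed

section \<open>Nonlocal energies and Lipschitz cutoffs\<close>

lemma powr_add_le:
  fixes a b p :: real
  assumes "0 \<le> p" "0 \<le> a" "0 \<le> b"
  shows "(a + b) powr p \<le> 2 powr p * (a powr p + b powr p)"
proof -
  have "(a + b) powr p \<le> (2 * max a b) powr p"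
    using assms by (intro powr_mono2) auto
  also have "\<dots> = 2 powr p * max a b powr p"
    using assms by (simp add: powr_mult)
  also have "\<dots> \<le> 2 powr p * (a powr p + b powr p)"
    by (intro mult_left_mono) (auto simp: max_def)
  finally show ?thesis .
qed

lemma ennreal_combine_le:
  fixes a b x y :: ennreal
  shows "a * x + b * y \<le> (a + b) * (x + y)"
proof -
  have "a * x + b * y \<le> a * (x + y) + b * (x + y)"
    by (intro add_mono mult_left_mono) auto
  then show ?thesis by (simp add: distrib_right)
qed

text \<open>
  Kernels are evaluated at nonnegative arguments only. Monotonicity is nevertheless required on
  the whole line, where it implies Borel measurability; a kernel on the half-line is brought into
  this form by giving it the value \<open>\<eta> 0\<close> at negative arguments.
\<close>
locale radial_kernel =
  fixes \<Omega> :: "(real ^ 'n) set" and \<eta> :: "real \<Rightarrow> real" and p :: real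
  assumes p: "p \<ge> 1"
    and kernel_nonneg: "\<And>t. 0 \<le> \<eta> t"
    and kernel_antimono: "antimono \<eta>"
    and moment_finite: "(\<integral>\<^sup>+z. ennreal (\<eta> (norm z) * norm z powr p) \<partial>(lborel :: (real ^ 'n) measure)) < \<infinity>"
    and domain_borel [measurable]: "\<Omega> \<in> sets borel"
begin

definition moment :: ennreal where
  "moment = (\<integral>\<^sup>+z. ennreal (\<eta> (norm z) * norm z powr p) \<partial>(lborel :: (real ^ 'n) measure))"

text \<open>
  The normalisation of the rescaled variation: \<open>\<epsilon>\<^sup>-\<^sup>p\<close> from the difference quotient and \<open>\<epsilon>\<^sup>-\<^sup>d\<close> from the
  rescaled kernel. It is kept apart from \<open>energy\<close>, which has an unnormalised kernel and so is
  monotone in its scale.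
\<close>
definition weight :: "real \<Rightarrow> real" where
  "weight \<epsilon> = 1 / (\<epsilon> powr p * \<epsilon> ^ CARD('n))"

definition mass :: "(real ^ 'n) set \<Rightarrow> (real ^ 'n \<Rightarrow> real) \<Rightarrow> ennreal" where
  "mass S u = (\<integral>\<^sup>+x\<in>S. ennreal (\<bar>u x\<bar> powr p) \<partial>lborel)"

definition energy :: "(real ^ 'n) set \<Rightarrow> real \<Rightarrow> (real ^ 'n \<Rightarrow> real) \<Rightarrow> ennreal" where
  "energy S \<epsilon> u = (\<integral>\<^sup>+x\<in>S. (\<integral>\<^sup>+y\<in>S. ennreal (\<eta> (norm (x - y) / \<epsilon>) * \<bar>u x - u y\<bar> powr p) \<partial>lborel) \<partial>lborel)"

lemma kernel_borel [measurable]: "\<eta> \<in> borel_measurable borel"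
proof -
  have "mono (\<lambda>t. - \<eta> t)"
    using antimonoD[OF kernel_antimono] by (auto intro: monoI)
  then have "(\<lambda>t. - \<eta> t) \<in> borel_measurable borel"
    by (rule borel_measurable_mono)
  then show ?thesis by simp
qed

text \<open>
  This allows estimates with different dilation factors \<open>B\<close> to be brought to the largest one.
\<close>
lemma energy_mono_scale:
  assumes "0 < s" "s \<le> t"
  shows "energy S s u \<le> energy S t u"
  unfolding energy_def using assms
  by (intro nn_integral_mono mult_right_mono ennreal_leI antimonoD[OF kernel_antimono] divide_left_mono)
    auto

lemma moment_translate_scale:
  fixes x :: "real ^ 'n"
  assumes "\<epsilon> > 0"
  shows "(\<integral>\<^sup>+y. ennreal (\<eta> (norm (x - y) / \<epsilon>) * norm (x - y) powr p) \<partial>lborel)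
    = ennreal (\<epsilon> powr p * \<epsilon> ^ CARD('n)) * moment"
proof -
  have "(\<integral>\<^sup>+y. ennreal (\<eta> (norm (x - y) / \<epsilon>) * norm (x - y) powr p) \<partial>lborel)
      = ennreal (\<epsilon> ^ CARD('n)) *
        (\<integral>\<^sup>+z. ennreal (\<eta> (norm (x - (x + \<epsilon> *\<^sub>R z)) / \<epsilon>) * norm (x - (x + \<epsilon> *\<^sub>R z)) powr p) \<partial>(lborel :: (real ^ 'n) measure))"
    using assms nn_integral_lborel_affine[of "\<lambda>y. ennreal (\<eta> (norm (x - y) / \<epsilon>) * norm (x - y) powr p)" \<epsilon> x]
    by simp
  also have "(\<integral>\<^sup>+z. ennreal (\<eta> (norm (x - (x + \<epsilon> *\<^sub>R z)) / \<epsilon>) * norm (x - (x + \<epsilon> *\<^sub>R z)) powr p) \<partial>(lborel :: (real ^ 'n) measure))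
      = (\<integral>\<^sup>+z. ennreal (\<epsilon> powr p) * ennreal (\<eta> (norm z) * norm z powr p) \<partial>(lborel :: (real ^ 'n) measure))"
    using assms by (intro nn_integral_cong) (simp add: powr_mult ac_simps flip: ennreal_mult')
  also have "\<dots> = ennreal (\<epsilon> powr p) * moment"
    unfolding moment_def by (rule nn_integral_cmult) measurable
  finally show ?thesis
    using assms by (simp add: ennreal_mult' ac_simps)
qed

lemma weight_pos: "\<epsilon> > 0 \<Longrightarrow> weight \<epsilon> > 0"
  by (simp add: weight_def)

lemma weight_cancel:
  assumes "\<epsilon> > 0"
  shows "ennreal (weight \<epsilon>) * (ennreal (\<epsilon> powr p * \<epsilon> ^ CARD('n)) * X) = X"
  using assms by (simp add: weight_def mult.assoc[symmetric] ennreal_mult'[symmetric])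

lemma mass_add_le:
  assumes [measurable]: "u \<in> borel_measurable borel" "v \<in> borel_measurable borel" "S \<in> sets borel"
  shows "mass S (\<lambda>x. u x + v x) \<le> ennreal (2 powr p) * (mass S u + mass S v)"
proof -
  have "mass S (\<lambda>x. u x + v x)
      \<le> (\<integral>\<^sup>+x. ennreal (2 powr p) * (ennreal (\<bar>u x\<bar> powr p) * indicator S x + ennreal (\<bar>v x\<bar> powr p) * indicator S x) \<partial>lborel)"
    unfolding mass_def
  proof (rule nn_integral_mono)
    fix x
    have "\<bar>u x + v x\<bar> powr p \<le> (\<bar>u x\<bar> + \<bar>v x\<bar>) powr p"
      using p by (intro powr_mono2) auto
    also have "\<dots> \<le> 2 powr p * (\<bar>u x\<bar> powr p + \<bar>v x\<bar> powr p)"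
      using p by (intro powr_add_le) auto
    finally show "ennreal (\<bar>u x + v x\<bar> powr p) * indicator S x
        \<le> ennreal (2 powr p) * (ennreal (\<bar>u x\<bar> powr p) * indicator S x + ennreal (\<bar>v x\<bar> powr p) * indicator S x)"
      by (auto simp: indicator_def ennreal_leI simp flip: ennreal_mult' ennreal_plus)
  qed
  also have "\<dots> = ennreal (2 powr p) * (mass S u + mass S v)"
    unfolding mass_def by (simp add: nn_integral_cmult nn_integral_add)
  finally show ?thesis .
qed

lemma energy_add_le:
  assumes [measurable]: "u \<in> borel_measurable borel" "v \<in> borel_measurable borel" "S \<in> sets borel"
    and "\<epsilon> > 0"
  shows "energy S \<epsilon> (\<lambda>x. u x + v x) \<le> ennreal (2 powr p) * (energy S \<epsilon> u + energy S \<epsilon> v)"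
proof -
  let ?e = "\<lambda>u x y. ennreal (\<eta> (norm (x - y) / \<epsilon>) * \<bar>u x - u y\<bar> powr p) * indicator S y * indicator S x"
  have *: "energy S \<epsilon> w = (\<integral>\<^sup>+x. \<integral>\<^sup>+y. ?e w x y \<partial>lborel \<partial>lborel)"
    if [measurable]: "w \<in> borel_measurable borel" for w
    unfolding energy_def by (simp add: nn_integral_multc)
  have "energy S \<epsilon> (\<lambda>x. u x + v x)
      \<le> (\<integral>\<^sup>+x. \<integral>\<^sup>+y. ennreal (2 powr p) * (?e u x y + ?e v x y) \<partial>lborel \<partial>lborel)"
    unfolding *[of "\<lambda>x. u x + v x", simplified]
  proof (intro nn_integral_mono)
    fix x y
    have "\<bar>u x + v x - (u y + v y)\<bar> powr p \<le> (\<bar>u x - u y\<bar> + \<bar>v x - v y\<bar>) powr p"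
      using p by (intro powr_mono2) auto
    also have "\<dots> \<le> 2 powr p * (\<bar>u x - u y\<bar> powr p + \<bar>v x - v y\<bar> powr p)"
      using p by (intro powr_add_le) auto
    finally have "\<eta> (norm (x - y) / \<epsilon>) * \<bar>u x + v x - (u y + v y)\<bar> powr p
        \<le> \<eta> (norm (x - y) / \<epsilon>) * (2 powr p * (\<bar>u x - u y\<bar> powr p + \<bar>v x - v y\<bar> powr p))"
      by (intro mult_left_mono kernel_nonneg)
    then have "ennreal (\<eta> (norm (x - y) / \<epsilon>) * \<bar>u x + v x - (u y + v y)\<bar> powr p)
        \<le> ennreal (2 powr p) * (ennreal (\<eta> (norm (x - y) / \<epsilon>) * \<bar>u x - u y\<bar> powr p)
           + ennreal (\<eta> (norm (x - y) / \<epsilon>) * \<bar>v x - v y\<bar> powr p))"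
      using kernel_nonneg
      by (auto simp: algebra_simps intro!: ennreal_leI simp flip: ennreal_mult' ennreal_plus)
    then show "ennreal (\<eta> (norm (x - y) / \<epsilon>) * \<bar>u x + v x - (u y + v y)\<bar> powr p) * indicator S y * indicator S x
        \<le> ennreal (2 powr p) * (?e u x y + ?e v x y)"
      by (auto simp: indicator_def)
  qed
  also have "\<dots> = ennreal (2 powr p) * (energy S \<epsilon> u + energy S \<epsilon> v)"
    unfolding *[OF assms(1)] *[OF assms(2)] by (simp add: nn_integral_cmult nn_integral_add)
  finally show ?thesis .
qed

text \<open>
  If both points lie in \<open>S\<close>, this is the product rule for increments. If only \<open>x\<close> does, then
  \<open>\<psi> x = \<psi> x - \<psi> y\<close> is at most \<open>\<Lambda> * norm (x - y)\<close>, so pairs on different sides of the boundary of \<open>S\<close>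
  obey the same bound however close they are.
\<close>
lemma multiplier_difference_le:
  fixes u \<psi> :: "real ^ 'n \<Rightarrow> real"
  assumes one: "\<And>x. \<bar>\<psi> x\<bar> \<le> 1" and lip: "\<And>x y. \<bar>\<psi> x - \<psi> y\<bar> \<le> \<Lambda> * norm (x - y)"
    and supp: "\<And>x. x \<notin> S \<Longrightarrow> \<psi> x = 0" and \<Lambda>: "\<Lambda> \<ge> 0"
  shows "\<bar>\<psi> x * u x - \<psi> y * u y\<bar> powr p
    \<le> 2 powr p * (\<bar>u x - u y\<bar> powr p * indicator S y * indicator S x
       + \<Lambda> powr p * norm (x - y) powr p * (\<bar>u x\<bar> powr p * indicator S x + \<bar>u y\<bar> powr p * indicator S y))"
    (is "?l \<le> ?r")
proof -
  have two: "1 \<le> 2 powr p" using p by (simp add: ge_one_powr_ge_zero)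
  define N where "N = norm (x - y)"
  have N: "N \<ge> 0" "norm (y - x) = N" by (simp_all add: N_def norm_minus_commute)
  have prod: "(\<Lambda> * N * \<bar>t\<bar>) powr p = \<Lambda> powr p * N powr p * \<bar>t\<bar> powr p" for t
    using \<Lambda> N by (simp add: powr_mult)
  consider "x \<in> S" "y \<in> S" | "x \<in> S" "y \<notin> S" | "x \<notin> S" "y \<in> S" | "x \<notin> S" "y \<notin> S" by blast
  then show ?thesis
  proof cases
    case 1
    have "\<psi> x * u x - \<psi> y * u y = \<psi> x * (u x - u y) + (\<psi> x - \<psi> y) * u y"
      by (simp add: algebra_simps)
    also have "\<bar>\<dots>\<bar> \<le> \<bar>\<psi> x\<bar> * \<bar>u x - u y\<bar> + \<bar>\<psi> x - \<psi> y\<bar> * \<bar>u y\<bar>"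
      by (metis abs_mult abs_triangle_ineq)
    also have "\<dots> \<le> 1 * \<bar>u x - u y\<bar> + \<Lambda> * N * \<bar>u y\<bar>"
      using one lip[of x y] by (intro add_mono mult_right_mono) (auto simp: N_def)
    finally have "?l \<le> (\<bar>u x - u y\<bar> + \<Lambda> * N * \<bar>u y\<bar>) powr p"
      using p by (intro powr_mono2) auto
    also have "\<dots> \<le> 2 powr p * (\<bar>u x - u y\<bar> powr p + \<Lambda> powr p * N powr p * \<bar>u y\<bar> powr p)"
      unfolding prod[symmetric] using p \<Lambda> N by (intro powr_add_le) auto
    also have "\<dots> \<le> ?r"
      using 1 \<Lambda> N by (simp add: N_def algebra_simps)
    finally show ?thesis .
  next
    case 2
    have "\<bar>\<psi> x * u x - \<psi> y * u y\<bar> = \<bar>\<psi> x - \<psi> y\<bar> * \<bar>u x\<bar>"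
      using supp[OF 2(2)] by (simp add: abs_mult)
    also have "\<dots> \<le> \<Lambda> * N * \<bar>u x\<bar>"
      using lip[of x y] by (intro mult_right_mono) (auto simp: N_def)
    finally have "?l \<le> 1 * (\<Lambda> * N * \<bar>u x\<bar>) powr p"
      using p by (simp add: powr_mono2)
    also have "\<dots> \<le> 2 powr p * (\<Lambda> * N * \<bar>u x\<bar>) powr p"
      using two by (intro mult_right_mono) auto
    finally show ?thesis using 2 unfolding prod by (simp add: N_def)
  next
    case 3
    have "\<bar>\<psi> x * u x - \<psi> y * u y\<bar> = \<bar>\<psi> y - \<psi> x\<bar> * \<bar>u y\<bar>"
      using supp[OF 3(1)] by (simp add: abs_mult)
    also have "\<dots> \<le> \<Lambda> * N * \<bar>u y\<bar>"
      using lip[of y x] N by (intro mult_right_mono) auto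
    finally have "?l \<le> 1 * (\<Lambda> * N * \<bar>u y\<bar>) powr p"
      using p by (simp add: powr_mono2)
    also have "\<dots> \<le> 2 powr p * (\<Lambda> * N * \<bar>u y\<bar>) powr p"
      using two by (intro mult_right_mono) auto
    finally show ?thesis using 3 unfolding prod by (simp add: N_def)
  next
    case 4
    then show ?thesis using supp by simp
  qed
qed

text \<open>
  The increments of the cutoff are integrated against the kernel by \<open>moment_translate_scale\<close>; the
  factor \<open>weight \<epsilon>\<close> cancels the power of \<open>\<epsilon>\<close> that arises, which makes the error uniform in \<open>\<epsilon>\<close>.
\<close>
lemma energy_multiplier_le:
  fixes u \<psi> :: "real ^ 'n \<Rightarrow> real"
  assumes [measurable]: "S \<in> sets borel" "u \<in> borel_measurable borel"
    and one: "\<And>x. \<bar>\<psi> x\<bar> \<le> 1" and lip: "\<And>x y. \<bar>\<psi> x - \<psi> y\<bar> \<le> \<Lambda> * norm (x - y)"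
    and supp: "\<And>x. x \<notin> S \<Longrightarrow> \<psi> x = 0" and \<Lambda>: "\<Lambda> \<ge> 0" and \<epsilon>: "\<epsilon> > 0"
  shows "ennreal (weight \<epsilon>) * energy UNIV \<epsilon> (\<lambda>x. \<psi> x * u x)
    \<le> ennreal (2 powr p) * (ennreal (weight \<epsilon>) * energy S \<epsilon> u + 2 * (ennreal (\<Lambda> powr p) * moment * mass S u))"
proof -
  define k where "k x y = \<eta> (norm (x - y) / \<epsilon>)" for x y :: "real ^ 'n"
  have k: "k x y \<ge> 0" "k x y = k y x" for x y
    by (simp_all add: k_def kernel_nonneg norm_minus_commute)
  have [measurable]: "(\<lambda>(x, y). k x y) \<in> borel_measurable (borel \<Otimes>\<^sub>M borel)" "k x \<in> borel_measurable borel" for x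
    unfolding k_def by measurable
  \<comment> \<open>\<open>a\<close> collects the increments of \<open>u\<close> inside \<open>S\<close>, \<open>b\<close> those of the cutoff.\<close>
  define a where "a x y = ennreal (k x y * \<bar>u x - u y\<bar> powr p) * indicator S y * indicator S x" for x y
  define b where "b x y = ennreal (\<bar>u x\<bar> powr p) * indicator S x * ennreal (k x y * norm (x - y) powr p)" for x y
  have [measurable]: "(\<lambda>(x, y). a x y) \<in> borel_measurable (borel \<Otimes>\<^sub>M borel)" "a x \<in> borel_measurable borel"
    "(\<lambda>(x, y). b x y) \<in> borel_measurable (borel \<Otimes>\<^sub>M borel)" "b x \<in> borel_measurable borel"
    "(\<lambda>y. b y x) \<in> borel_measurable borel" for x
    unfolding a_def b_def by measurable
  let ?L = "ennreal (\<Lambda> powr p)" and ?c = "ennreal (2 powr p)"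
  have "energy UNIV \<epsilon> (\<lambda>x. \<psi> x * u x) \<le> (\<integral>\<^sup>+x. \<integral>\<^sup>+y. ?c * (a x y + ?L * (b x y + b y x)) \<partial>lborel \<partial>lborel)"
    unfolding energy_def k_def[symmetric]
  proof (simp, intro nn_integral_mono)
    fix x y :: "real ^ 'n"
    have "k x y * \<bar>\<psi> x * u x - \<psi> y * u y\<bar> powr p
      \<le> k x y * (2 powr p * (\<bar>u x - u y\<bar> powr p * indicator S y * indicator S x
       + \<Lambda> powr p * norm (x - y) powr p * (\<bar>u x\<bar> powr p * indicator S x + \<bar>u y\<bar> powr p * indicator S y)))"
      by (intro mult_left_mono multiplier_difference_le one lip supp \<Lambda> k)
    also have "\<dots> = 2 powr p * (k x y * \<bar>u x - u y\<bar> powr p * indicator S y * indicator S x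
       + \<Lambda> powr p * (\<bar>u x\<bar> powr p * indicator S x * (k x y * norm (x - y) powr p)
                     + \<bar>u y\<bar> powr p * indicator S y * (k x y * norm (x - y) powr p)))"
      by (simp add: algebra_simps)
    finally have "ennreal (k x y * \<bar>\<psi> x * u x - \<psi> y * u y\<bar> powr p) \<le> ennreal \<dots>"
      by (rule ennreal_leI)
    also have "\<dots> = ?c * (a x y + ?L * (b x y + b y x))"
      unfolding a_def b_def k(2)[of y x] norm_minus_commute[of y x] using k(1)[of x y]
      by (simp add: ennreal_mult' ennreal_plus ennreal_indicator[symmetric])
    finally show "ennreal (k x y * \<bar>\<psi> x * u x - \<psi> y * u y\<bar> powr p) \<le> ?c * (a x y + ?L * (b x y + b y x))" .
  qed
  also have "\<dots> = ?c * ((\<integral>\<^sup>+x. \<integral>\<^sup>+y. a x y \<partial>lborel \<partial>lborel)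
      + ?L * ((\<integral>\<^sup>+x. \<integral>\<^sup>+y. b x y \<partial>lborel \<partial>lborel) + (\<integral>\<^sup>+x. \<integral>\<^sup>+y. b y x \<partial>lborel \<partial>lborel)))"
    by (simp add: nn_integral_cmult nn_integral_add)
  also have "(\<integral>\<^sup>+x. \<integral>\<^sup>+y. a x y \<partial>lborel \<partial>lborel) = energy S \<epsilon> u"
    unfolding energy_def a_def k_def by (simp add: nn_integral_multc)
  also have "(\<integral>\<^sup>+x. \<integral>\<^sup>+y. b y x \<partial>lborel \<partial>lborel) = (\<integral>\<^sup>+x. \<integral>\<^sup>+y. b x y \<partial>lborel \<partial>lborel)"
    by (rule lborel_pair.Fubini') measurable
  also have "(\<integral>\<^sup>+x. \<integral>\<^sup>+y. b x y \<partial>lborel \<partial>lborel)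
      = ennreal (\<epsilon> powr p * \<epsilon> ^ CARD('n)) * (moment * mass S u)"
  proof -
    have "(\<integral>\<^sup>+y. b x y \<partial>lborel) = ennreal (\<epsilon> powr p * \<epsilon> ^ CARD('n)) * moment * (ennreal (\<bar>u x\<bar> powr p) * indicator S x)" for x
    proof -
      have "(\<integral>\<^sup>+y. b x y \<partial>lborel) = ennreal (\<bar>u x\<bar> powr p) * indicator S x *
          (\<integral>\<^sup>+y. ennreal (\<eta> (norm (x - y) / \<epsilon>) * norm (x - y) powr p) \<partial>lborel)"
        unfolding b_def k_def by (rule nn_integral_cmult) measurable
      also have "\<dots> = ennreal (\<bar>u x\<bar> powr p) * indicator S x * (ennreal (\<epsilon> powr p * \<epsilon> ^ CARD('n)) * moment)"
        by (simp only: moment_translate_scale[OF \<epsilon>])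
      finally show ?thesis by (simp only: mult_ac)
    qed
    then show ?thesis
      by (simp add: nn_integral_cmult mass_def mult.assoc)
  qed
  finally have "ennreal (weight \<epsilon>) * energy UNIV \<epsilon> (\<lambda>x. \<psi> x * u x) \<le> ennreal (weight \<epsilon>) *
      (?c * (energy S \<epsilon> u + ?L * (ennreal (\<epsilon> powr p * \<epsilon> ^ CARD('n)) * (moment * mass S u)
         + ennreal (\<epsilon> powr p * \<epsilon> ^ CARD('n)) * (moment * mass S u))))"
    by (rule mult_left_mono) simp
  also have "\<dots> = ?c * (ennreal (weight \<epsilon>) * energy S \<epsilon> u
      + ?L * (ennreal (weight \<epsilon>) * (ennreal (\<epsilon> powr p * \<epsilon> ^ CARD('n)) * (moment * mass S u))
         + ennreal (weight \<epsilon>) * (ennreal (\<epsilon> powr p * \<epsilon> ^ CARD('n)) * (moment * mass S u))))"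
    by (simp only: distrib_left mult.assoc mult.left_commute)
  also have "\<dots> = ?c * (ennreal (weight \<epsilon>) * energy S \<epsilon> u + 2 * (?L * moment * mass S u))"
    unfolding weight_cancel[OF \<epsilon>] by (simp add: mult_2 distrib_left mult.assoc)
  finally show ?thesis .
qed

section \<open>Operators bounded in norm and energy\<close>


text \<open>
  Linearity holds pointwise and for all functions, since every operator below has the form
  \<open>f \<mapsto> \<Sum>i. \<phi>\<^sub>i * (f \<circ> T\<^sub>i)\<close>. One pair of constants serves all \<open>f\<close> and all \<open>\<epsilon>\<close>.
\<close>
definition bounded_operator :: "((real ^ 'n \<Rightarrow> real) \<Rightarrow> real ^ 'n \<Rightarrow> real) \<Rightarrow> bool" where
  "bounded_operator X \<longleftrightarrow>
     (\<forall>f\<in>borel_measurable borel. X f \<in> borel_measurable borel) \<and>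
     (\<forall>f g. X (\<lambda>x. f x + g x) = (\<lambda>x. X f x + X g x)) \<and>
     (\<forall>c f. X (\<lambda>x. c * f x) = (\<lambda>x. c * X f x)) \<and>
     (\<exists>A B. A < \<infinity> \<and> B \<ge> 1 \<and> (\<forall>f\<in>borel_measurable borel. mass UNIV (X f) \<le> A * mass \<Omega> f \<and>
        (\<forall>\<epsilon>>0. ennreal (weight \<epsilon>) * energy UNIV \<epsilon> (X f)
           \<le> A * (mass \<Omega> f + ennreal (weight \<epsilon>) * energy \<Omega> (B * \<epsilon>) f))))"

lemma bounded_operatorI:
  fixes A :: ennreal and B :: real
  assumes "\<And>f. f \<in> borel_measurable borel \<Longrightarrow> X f \<in> borel_measurable borel"
    and "\<And>f g x. X (\<lambda>x. f x + g x) x = X f x + X g x"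
    and "\<And>c f x. X (\<lambda>x. c * f x) x = c * X f x"
    and "A < \<infinity>" "B \<ge> 1"
    and "\<And>f. f \<in> borel_measurable borel \<Longrightarrow> mass UNIV (X f) \<le> A * mass \<Omega> f"
    and "\<And>f \<epsilon>. f \<in> borel_measurable borel \<Longrightarrow> \<epsilon> > 0 \<Longrightarrow> ennreal (weight \<epsilon>) * energy UNIV \<epsilon> (X f)
           \<le> A * (mass \<Omega> f + ennreal (weight \<epsilon>) * energy \<Omega> (B * \<epsilon>) f)"
  shows "bounded_operator X"
  unfolding bounded_operator_def
  by (intro conjI exI[of _ A] exI[of _ B] ballI allI impI ext assms)

lemma bounded_operatorE:
  assumes "bounded_operator X"
  obtains A B where "A < \<infinity>" "B \<ge> 1"
    "\<And>f. f \<in> borel_measurable borel \<Longrightarrow> mass UNIV (X f) \<le> A * mass \<Omega> f"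
    "\<And>f \<epsilon>. f \<in> borel_measurable borel \<Longrightarrow> \<epsilon> > 0 \<Longrightarrow> ennreal (weight \<epsilon>) * energy UNIV \<epsilon> (X f)
           \<le> A * (mass \<Omega> f + ennreal (weight \<epsilon>) * energy \<Omega> (B * \<epsilon>) f)"
  using assms unfolding bounded_operator_def by blast

lemma bounded_operatorD:
  assumes "bounded_operator X"
  shows "f \<in> borel_measurable borel \<Longrightarrow> X f \<in> borel_measurable borel"
    and "X (\<lambda>x. f x + g x) x = X f x + X g x"
    and "X (\<lambda>x. c * f x) x = c * X f x"
  using assms unfolding bounded_operator_def by auto

lemma lipschitz_borel:
  fixes \<psi> :: "real ^ 'n \<Rightarrow> real"
  assumes "\<And>x y. \<bar>\<psi> x - \<psi> y\<bar> \<le> \<Lambda> * norm (x - y)" "\<Lambda> \<ge> 0"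
  shows "\<psi> \<in> borel_measurable borel"
proof -
  have "\<Lambda>-lipschitz_on UNIV \<psi>"
    using assms by (auto simp: lipschitz_on_def dist_norm)
  then show ?thesis
    by (intro borel_measurable_continuous_onI lipschitz_on_continuous_on)
qed

lemma bounded_operator_zero: "bounded_operator (\<lambda>f x. 0)"
  by (rule bounded_operatorI[of _ 0 1]) (auto simp: mass_def energy_def)

lemma bounded_operator_add:
  assumes X: "bounded_operator X" and Y: "bounded_operator Y"
  shows "bounded_operator (\<lambda>f x. X f x + Y f x)"
proof -
  obtain A B where A: "A < \<infinity>" "B \<ge> 1"
    "\<And>f. f \<in> borel_measurable borel \<Longrightarrow> mass UNIV (X f) \<le> A * mass \<Omega> f"
    "\<And>f \<epsilon>. f \<in> borel_measurable borel \<Longrightarrow> \<epsilon> > 0 \<Longrightarrow> ennreal (weight \<epsilon>) * energy UNIV \<epsilon> (X f)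
           \<le> A * (mass \<Omega> f + ennreal (weight \<epsilon>) * energy \<Omega> (B * \<epsilon>) f)"
    using bounded_operatorE[OF X] by blast
  obtain A' B' where A': "A' < \<infinity>" "B' \<ge> 1"
    "\<And>f. f \<in> borel_measurable borel \<Longrightarrow> mass UNIV (Y f) \<le> A' * mass \<Omega> f"
    "\<And>f \<epsilon>. f \<in> borel_measurable borel \<Longrightarrow> \<epsilon> > 0 \<Longrightarrow> ennreal (weight \<epsilon>) * energy UNIV \<epsilon> (Y f)
           \<le> A' * (mass \<Omega> f + ennreal (weight \<epsilon>) * energy \<Omega> (B' * \<epsilon>) f)"
    using bounded_operatorE[OF Y] by blast
  let ?c = "ennreal (2 powr p)" and ?B = "max B B'"
  show ?thesis
  proof (rule bounded_operatorI[of _ "?c * (A + A')" ?B])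
    fix f :: "real ^ 'n \<Rightarrow> real" assume f: "f \<in> borel_measurable borel"
    have [measurable]: "X f \<in> borel_measurable borel" "Y f \<in> borel_measurable borel"
      using bounded_operatorD(1)[OF X f] bounded_operatorD(1)[OF Y f] .
    show "(\<lambda>x. X f x + Y f x) \<in> borel_measurable borel" by measurable
    have "mass UNIV (\<lambda>x. X f x + Y f x) \<le> ?c * (mass UNIV (X f) + mass UNIV (Y f))"
      by (rule mass_add_le) auto
    also have "\<dots> \<le> ?c * (A * mass \<Omega> f + A' * mass \<Omega> f)"
      by (intro mult_left_mono add_mono A A' f) auto
    finally show "mass UNIV (\<lambda>x. X f x + Y f x) \<le> ?c * (A + A') * mass \<Omega> f"
      by (simp add: distrib_right mult.assoc)
    fix \<epsilon> :: real assume \<epsilon>: "\<epsilon> > 0"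
    let ?w = "ennreal (weight \<epsilon>)"
    have "?w * energy UNIV \<epsilon> (\<lambda>x. X f x + Y f x) \<le> ?w * (?c * (energy UNIV \<epsilon> (X f) + energy UNIV \<epsilon> (Y f)))"
      by (intro mult_left_mono energy_add_le \<epsilon>) auto
    also have "\<dots> = ?c * (?w * energy UNIV \<epsilon> (X f) + ?w * energy UNIV \<epsilon> (Y f))"
      by (simp only: distrib_left mult.left_commute)
    also have "\<dots> \<le> ?c * (A * (mass \<Omega> f + ?w * energy \<Omega> (B * \<epsilon>) f) + A' * (mass \<Omega> f + ?w * energy \<Omega> (B' * \<epsilon>) f))"
      by (intro mult_left_mono add_mono A A' f \<epsilon>) auto
    also have "\<dots> \<le> ?c * (A * (mass \<Omega> f + ?w * energy \<Omega> (?B * \<epsilon>) f) + A' * (mass \<Omega> f + ?w * energy \<Omega> (?B * \<epsilon>) f))"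
      using A(2) A'(2) \<epsilon> by (intro mult_left_mono add_mono order_refl energy_mono_scale mult_right_mono) auto
    finally show "?w * energy UNIV \<epsilon> (\<lambda>x. X f x + Y f x)
        \<le> ?c * (A + A') * (mass \<Omega> f + ?w * energy \<Omega> (?B * \<epsilon>) f)"
      by (simp add: distrib_right mult.assoc)
  qed (use A A' in \<open>auto simp: bounded_operatorD[OF X] bounded_operatorD[OF Y] ennreal_mult_less_top algebra_simps\<close>)
qed

lemma bounded_operator_multiplier:
  assumes X: "bounded_operator X"
    and one: "\<And>x. \<bar>\<psi> x\<bar> \<le> 1" and lip: "\<And>x y. \<bar>\<psi> x - \<psi> y\<bar> \<le> \<Lambda> * norm (x - y)" and \<Lambda>: "\<Lambda> \<ge> 0"
  shows "bounded_operator (\<lambda>f x. \<psi> x * X f x)"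
proof -
  obtain A B where A: "A < \<infinity>" "B \<ge> 1"
    "\<And>f. f \<in> borel_measurable borel \<Longrightarrow> mass UNIV (X f) \<le> A * mass \<Omega> f"
    "\<And>f \<epsilon>. f \<in> borel_measurable borel \<Longrightarrow> \<epsilon> > 0 \<Longrightarrow> ennreal (weight \<epsilon>) * energy UNIV \<epsilon> (X f)
           \<le> A * (mass \<Omega> f + ennreal (weight \<epsilon>) * energy \<Omega> (B * \<epsilon>) f)"
    using bounded_operatorE[OF X] by blast
  have [measurable]: "\<psi> \<in> borel_measurable borel" by (rule lipschitz_borel[OF lip \<Lambda>])
  define c where "c = ennreal (2 powr p)"
  have c: "c < \<infinity>" "1 \<le> c"
    using p by (auto simp: c_def ge_one_powr_ge_zero)
  define l where "l = ennreal (\<Lambda> powr p) * moment"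
  have l: "l < \<infinity>" using moment_finite by (simp add: l_def moment_def ennreal_mult_less_top)
  show ?thesis
  proof (rule bounded_operatorI[of _ "c * (A + 2 * (l * A))" B])
    fix f :: "real ^ 'n \<Rightarrow> real" assume f: "f \<in> borel_measurable borel"
    have [measurable]: "X f \<in> borel_measurable borel"
      using bounded_operatorD(1)[OF X f] .
    show "(\<lambda>x. \<psi> x * X f x) \<in> borel_measurable borel" by measurable
    have "mass UNIV (\<lambda>x. \<psi> x * X f x) \<le> mass UNIV (X f)"
      unfolding mass_def
      using one p by (intro nn_integral_mono mult_right_mono ennreal_leI powr_mono2)
        (auto simp: abs_mult mult_left_le_one_le)
    also have "\<dots> \<le> 1 * (A * mass \<Omega> f)" using A(3)[OF f] by simp
    also have "\<dots> \<le> c * ((A + 2 * (l * A)) * mass \<Omega> f)"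
      by (intro mult_mono mult_right_mono c) auto
    finally show "mass UNIV (\<lambda>x. \<psi> x * X f x) \<le> c * (A + 2 * (l * A)) * mass \<Omega> f"
      by (simp add: mult.assoc)
    fix \<epsilon> :: real assume \<epsilon>: "\<epsilon> > 0"
    let ?w = "ennreal (weight \<epsilon>)"
    let ?R = "mass \<Omega> f + ?w * energy \<Omega> (B * \<epsilon>) f"
    have "?w * energy UNIV \<epsilon> (\<lambda>x. \<psi> x * X f x) \<le> c * (?w * energy UNIV \<epsilon> (X f) + 2 * (l * mass UNIV (X f)))"
      unfolding c_def l_def by (rule energy_multiplier_le) (use one lip \<Lambda> \<epsilon> in auto)
    also have "\<dots> \<le> c * (A * ?R + 2 * (l * (A * ?R)))"
      by (intro mult_left_mono add_mono A f \<epsilon> order_trans[OF A(3)[OF f]]) auto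
    finally show "?w * energy UNIV \<epsilon> (\<lambda>x. \<psi> x * X f x) \<le> c * (A + 2 * (l * A)) * ?R"
      by (simp add: distrib_right mult.assoc)
  qed (use A c l in \<open>auto simp: bounded_operatorD[OF X] ennreal_mult_less_top algebra_simps\<close>)
qed

text \<open>
  The energy of \<open>f \<circ> T\<close> on \<open>S\<close> is compared with that of \<open>f\<close> on \<open>\<Omega>\<close> by the monotone kernel and two
  applications of the change of variables \<open>push\<close>, one in each variable; the cutoff then spreads the
  estimate from \<open>S\<close> to the whole space.
\<close>
lemma bounded_operator_fold:
  assumes one: "\<And>x. \<bar>\<psi> x\<bar> \<le> 1" and lip: "\<And>x y. \<bar>\<psi> x - \<psi> y\<bar> \<le> \<Lambda> * norm (x - y)"
    and supp: "\<And>x. x \<notin> S \<Longrightarrow> \<psi> x = 0" and \<Lambda>: "\<Lambda> \<ge> 0"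
    and [measurable]: "S \<in> sets borel" "T \<in> borel_measurable borel"
    and K: "K \<ge> 1" and T: "\<And>x y. dist (T x) (T y) \<le> K * dist x y"
    and push: "\<And>F. F \<in> borel_measurable borel \<Longrightarrow>
       (\<integral>\<^sup>+x\<in>S. F (T x) \<partial>lborel) \<le> 2 * (\<integral>\<^sup>+x\<in>\<Omega>. F x \<partial>lborel)"
  shows "bounded_operator (\<lambda>f x. \<psi> x * f (T x))"
proof -
  have [measurable]: "\<psi> \<in> borel_measurable borel" by (rule lipschitz_borel[OF lip \<Lambda>])
  define c where "c = ennreal (2 powr p)"
  have c: "c < \<infinity>" "1 \<le> c"
    using p by (auto simp: c_def ge_one_powr_ge_zero)
  define l where "l = ennreal (\<Lambda> powr p) * moment"
  have l: "l < \<infinity>" using moment_finite by (simp add: l_def moment_def ennreal_mult_less_top)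
  show ?thesis
  proof (rule bounded_operatorI[of _ "c * (4 + 4 * l)" K])
    fix f :: "real ^ 'n \<Rightarrow> real" assume [measurable]: "f \<in> borel_measurable borel"
    show "(\<lambda>x. \<psi> x * f (T x)) \<in> borel_measurable borel" by measurable
    have mass: "mass S (\<lambda>x. f (T x)) \<le> 2 * mass \<Omega> f"
      unfolding mass_def by (rule push) measurable
    have "mass UNIV (\<lambda>x. \<psi> x * f (T x)) \<le> mass S (\<lambda>x. f (T x))"
      unfolding mass_def
    proof (rule nn_integral_mono)
      fix x
      have "\<bar>\<psi> x * f (T x)\<bar> powr p \<le> \<bar>f (T x)\<bar> powr p"
        using one[of x] p by (intro powr_mono2) (auto simp: abs_mult mult_left_le_one_le)
      then show "ennreal (\<bar>\<psi> x * f (T x)\<bar> powr p) * indicator UNIV x \<le> ennreal (\<bar>f (T x)\<bar> powr p) * indicator S x"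
        using supp[of x] by (cases "x \<in> S") (auto intro: ennreal_leI)
    qed
    also have "\<dots> \<le> 1 * (2 * mass \<Omega> f)" using mass by simp
    also have "\<dots> \<le> c * ((4 + 4 * l) * mass \<Omega> f)"
    proof (intro mult_mono mult_right_mono c)
      show "2 \<le> 4 + 4 * l" by (rule order_trans[of _ 4]) auto
    qed auto
    finally show "mass UNIV (\<lambda>x. \<psi> x * f (T x)) \<le> c * (4 + 4 * l) * mass \<Omega> f"
      by (simp add: mult.assoc)
    fix \<epsilon> :: real assume \<epsilon>: "\<epsilon> > 0"
    let ?w = "ennreal (weight \<epsilon>)"
    define k where "k a b = ennreal (\<eta> (norm (a - b) / (K * \<epsilon>)) * \<bar>f a - f b\<bar> powr p)" for a b
    have [measurable]: "(\<lambda>(x, y). k x y) \<in> borel_measurable (borel \<Otimes>\<^sub>M borel)" "k x \<in> borel_measurable borel" for x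
      unfolding k_def by measurable
    have "energy S \<epsilon> (\<lambda>x. f (T x)) \<le> (\<integral>\<^sup>+x\<in>S. (\<integral>\<^sup>+y\<in>S. k (T x) (T y) \<partial>lborel) \<partial>lborel)"
      unfolding energy_def k_def
    proof (intro nn_integral_mono mult_right_mono ennreal_leI antimonoD[OF kernel_antimono])
      fix x y
      show "norm (T x - T y) / (K * \<epsilon>) \<le> norm (x - y) / \<epsilon>"
        using T[of x y] K \<epsilon> by (simp add: dist_norm field_simps)
    qed auto
    also have "\<dots> \<le> (\<integral>\<^sup>+x\<in>S. (2 * (\<integral>\<^sup>+y\<in>\<Omega>. k (T x) y \<partial>lborel)) \<partial>lborel)"
      by (intro nn_integral_mono mult_right_mono push) auto
    also have "\<dots> \<le> 2 * (\<integral>\<^sup>+x\<in>\<Omega>. (2 * (\<integral>\<^sup>+y\<in>\<Omega>. k x y \<partial>lborel)) \<partial>lborel)"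
      by (rule push[where F = "\<lambda>a. 2 * (\<integral>\<^sup>+y\<in>\<Omega>. k a y \<partial>lborel)"]) measurable
    also have "\<dots> = 4 * energy \<Omega> (K * \<epsilon>) f"
      unfolding energy_def k_def
      by (simp add: mult.assoc nn_integral_cmult)
    finally have en: "energy S \<epsilon> (\<lambda>x. f (T x)) \<le> 4 * energy \<Omega> (K * \<epsilon>) f" .
    have "?w * energy UNIV \<epsilon> (\<lambda>x. \<psi> x * f (T x))
        \<le> c * (?w * energy S \<epsilon> (\<lambda>x. f (T x)) + 2 * (l * mass S (\<lambda>x. f (T x))))"
      unfolding c_def l_def by (rule energy_multiplier_le) (use one lip supp \<Lambda> \<epsilon> in auto)
    also have "\<dots> \<le> c * (?w * (4 * energy \<Omega> (K * \<epsilon>) f) + 2 * (l * (2 * mass \<Omega> f)))"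
      by (intro mult_left_mono add_mono en mass) auto
    also have "?w * (4 * energy \<Omega> (K * \<epsilon>) f) + 2 * (l * (2 * mass \<Omega> f))
        = 4 * (?w * energy \<Omega> (K * \<epsilon>) f) + 4 * l * mass \<Omega> f"
      by (simp add: ac_simps)
    also have "\<dots> \<le> (4 + 4 * l) * (?w * energy \<Omega> (K * \<epsilon>) f + mass \<Omega> f)"
      by (rule ennreal_combine_le)
    finally show "?w * energy UNIV \<epsilon> (\<lambda>x. \<psi> x * f (T x))
        \<le> c * (4 + 4 * l) * (mass \<Omega> f + ?w * energy \<Omega> (K * \<epsilon>) f)"
      by (simp add: mult.assoc add.commute mult_left_mono)
  qed (use K c l in \<open>auto simp: ennreal_mult_less_top algebra_simps\<close>)
qed

section \<open>Gluing local extensions\<close>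


text \<open>
  A local extension near \<open>c\<close>, already multiplied by its cutoff \<open>\<psi>\<close>. The identity \<open>Z f = \<psi> * f\<close> on all of
  \<open>\<Omega>\<close>, not only near \<open>c\<close>, is what keeps the gluing consistent.
\<close>
definition extension_patch :: "real ^ 'n \<Rightarrow> real \<Rightarrow> bool" where
  "extension_patch c r \<longleftrightarrow> r > 0 \<and> (\<exists>\<psi> \<Lambda> Z. \<Lambda> \<ge> 0 \<and> (\<forall>x. 0 \<le> \<psi> x \<and> \<psi> x \<le> 1) \<and>
     (\<forall>x y. \<bar>\<psi> x - \<psi> y\<bar> \<le> \<Lambda> * norm (x - y)) \<and> (\<forall>x\<in>ball c r. \<psi> x = 1) \<and>
     bounded_operator Z \<and> (\<forall>f. \<forall>x\<in>\<Omega>. Z f x = \<psi> x * f x))"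

lemma extension_patch_exists:
  assumes "open \<Omega>" "lipschitz_boundary \<Omega>" "c \<in> closure \<Omega>"
  shows "\<exists>r. extension_patch c r"
proof -
  obtain s K T where s: "s > 0" and K: "K \<ge> 1" and T_borel: "T \<in> borel_measurable borel"
    and T: "\<And>x y. dist (T x) (T y) \<le> K * dist x y"
    and T_id: "\<And>x. x \<in> \<Omega> \<inter> ball c s \<Longrightarrow> T x = x"
    and push: "\<And>F. F \<in> borel_measurable borel \<Longrightarrow>
       (\<integral>\<^sup>+x\<in>ball c s. F (T x) \<partial>lborel) \<le> 2 * (\<integral>\<^sup>+x\<in>\<Omega>. F x \<partial>lborel)"
    using lipschitz_fold_into_domain[OF assms] by blast
  \<comment> \<open>Equal to one on the ball of radius \<open>s / 2\<close> and supported in the ball of radius \<open>s\<close>.\<close>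
  define \<psi> where "\<psi> x = max 0 (min 1 (2 - 2 / s * dist c x))" for x
  have range: "0 \<le> \<psi> x" "\<psi> x \<le> 1" for x by (auto simp: \<psi>_def)
  have lip: "\<bar>\<psi> x - \<psi> y\<bar> \<le> 2 / s * norm (x - y)" for x y
  proof -
    have "\<bar>\<psi> x - \<psi> y\<bar> \<le> \<bar>(2 - 2 / s * dist c x) - (2 - 2 / s * dist c y)\<bar>"
      by (auto simp: \<psi>_def max_def min_def)
    also have "(2 - 2 / s * dist c x) - (2 - 2 / s * dist c y) = 2 / s * (dist c y - dist c x)"
      by (simp add: algebra_simps)
    also have "\<bar>\<dots>\<bar> = 2 / s * \<bar>dist c x - dist c y\<bar>"
      unfolding abs_mult abs_minus_commute[of "dist c y"] using s by simp
    also have "\<dots> \<le> 2 / s * norm (x - y)"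
      using s abs_dist_diff_le[of x c y] by (intro mult_left_mono) (auto simp: dist_norm norm_minus_commute)
    finally show ?thesis .
  qed
  have supp: "\<psi> x = 0" if "x \<notin> ball c s" for x
    using that s by (auto simp: \<psi>_def field_simps)
  have near: "\<psi> x = 1" if "x \<in> ball c (s / 2)" for x
    using that s by (auto simp: \<psi>_def field_simps)
  have "bounded_operator (\<lambda>f x. \<psi> x * f (T x))"
    using range s by (intro bounded_operator_fold[of \<psi> "2 / s" "ball c s" T K] lip supp T_borel K T push) auto
  moreover have "\<psi> x * f (T x) = \<psi> x * f x" if "x \<in> \<Omega>" for f x
    using T_id[of x] supp[of x] that by (cases "x \<in> ball c s") auto
  ultimately have "extension_patch c (s / 2)"
    unfolding extension_patch_def using range lip near s
    by (intro conjI exI[of _ \<psi>] exI[of _ "2 / s"] exI[of _ "\<lambda>f x. \<psi> x * f (T x)"]) auto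
  then show ?thesis ..
qed

text \<open>
  Patches are added one at a time by \<open>X f \<leadsto> (1 - \<psi>) * X f + Z f\<close>. Where \<open>X f\<close> already agrees with \<open>f\<close> on
  \<open>\<Omega>\<close> the new value is \<open>(1 - \<psi>) * f + \<psi> * f\<close>, and on the new ball, where \<open>\<psi> = 1\<close>, it is \<open>Z f = f\<close>.
\<close>
lemma bounded_operator_glue:
  assumes "finite F" "\<And>c. c \<in> F \<Longrightarrow> extension_patch c (r c)"
  shows "\<exists>X. bounded_operator X \<and> (\<forall>f. \<forall>x\<in>\<Omega> \<inter> (\<Union>c\<in>F. ball c (r c)). X f x = f x)"
  using assms
proof (induction F rule: finite_induct)
  case empty
  show ?case by (intro exI[of _ "\<lambda>f x. 0"] conjI bounded_operator_zero) simp
next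
  case (insert c F)
  have "\<exists>X. bounded_operator X \<and> (\<forall>f. \<forall>x\<in>\<Omega> \<inter> (\<Union>c\<in>F. ball c (r c)). X f x = f x)"
    by (rule insert.IH) (simp add: insert.prems)
  then obtain X where X: "bounded_operator X"
    "\<And>f x. x \<in> \<Omega> \<inter> (\<Union>c\<in>F. ball c (r c)) \<Longrightarrow> X f x = f x"
    by blast
  have "extension_patch c (r c)" using insert.prems by simp
  then have "\<exists>\<psi> \<Lambda> Z. \<Lambda> \<ge> 0 \<and> (\<forall>x. 0 \<le> \<psi> x \<and> \<psi> x \<le> 1) \<and>
     (\<forall>x y. \<bar>\<psi> x - \<psi> y\<bar> \<le> \<Lambda> * norm (x - y)) \<and> (\<forall>x\<in>ball c (r c). \<psi> x = 1) \<and>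
     bounded_operator Z \<and> (\<forall>f. \<forall>x\<in>\<Omega>. Z f x = \<psi> x * f x)"
    unfolding extension_patch_def by (rule conjunct2)
  then obtain \<psi> \<Lambda> Z where *: "\<Lambda> \<ge> 0 \<and> (\<forall>x. 0 \<le> \<psi> x \<and> \<psi> x \<le> 1) \<and>
     (\<forall>x y. \<bar>\<psi> x - \<psi> y\<bar> \<le> \<Lambda> * norm (x - y)) \<and> (\<forall>x\<in>ball c (r c). \<psi> x = 1) \<and>
     bounded_operator Z \<and> (\<forall>f. \<forall>x\<in>\<Omega>. Z f x = \<psi> x * f x)"
    by (elim exE)
  then have \<Lambda>: "\<Lambda> \<ge> 0" and range: "\<And>x. 0 \<le> \<psi> x" "\<And>x. \<psi> x \<le> 1"
    and lip: "\<And>x y. \<bar>\<psi> x - \<psi> y\<bar> \<le> \<Lambda> * norm (x - y)"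
    and near: "\<And>x. x \<in> ball c (r c) \<Longrightarrow> \<psi> x = 1"
    and Z: "bounded_operator Z" "\<And>f x. x \<in> \<Omega> \<Longrightarrow> Z f x = \<psi> x * f x"
    by simp_all
  have "bounded_operator (\<lambda>f x. (1 - \<psi> x) * X f x)"
  proof (rule bounded_operator_multiplier[OF X(1) _ _ \<Lambda>])
    fix x y
    show "\<bar>1 - \<psi> x\<bar> \<le> 1" using range[of x] by simp
    show "\<bar>(1 - \<psi> x) - (1 - \<psi> y)\<bar> \<le> \<Lambda> * norm (x - y)"
      using lip[of x y] by (simp add: abs_minus_commute)
  qed
  then have "bounded_operator (\<lambda>f x. (1 - \<psi> x) * X f x + Z f x)"
    using Z(1) by (rule bounded_operator_add)
  moreover have "(1 - \<psi> x) * X f x + Z f x = f x" if "x \<in> \<Omega> \<inter> (\<Union>c\<in>insert c F. ball c (r c))" for f x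
  proof (cases "x \<in> ball c (r c)")
    case True
    then show ?thesis using near[OF True] Z(2)[of x f] that by simp
  next
    case False
    then show ?thesis using X(2)[of x f] Z(2)[of x f] that by (auto simp: algebra_simps)
  qed
  ultimately show ?case by blast
qed

lemma bounded_extension_exists:
  assumes "open \<Omega>" "bounded \<Omega>" "lipschitz_boundary \<Omega>"
  obtains X where "bounded_operator X" "\<And>f x. x \<in> \<Omega> \<Longrightarrow> X f x = f x"
proof -
  obtain r where r: "\<And>c. c \<in> closure \<Omega> \<Longrightarrow> extension_patch c (r c)"
    using extension_patch_exists[OF assms(1,3)] by metis
  have "compact (closure \<Omega>)" using assms(2) by (simp add: compact_closure)
  moreover have "closure \<Omega> \<subseteq> (\<Union>c\<in>closure \<Omega>. ball c (r c))"
  proof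
    fix c assume "c \<in> closure \<Omega>"
    then show "c \<in> (\<Union>c\<in>closure \<Omega>. ball c (r c))"
      using r[of c] unfolding extension_patch_def by (intro UN_I[of c]) auto
  qed
  ultimately obtain F where F: "F \<subseteq> closure \<Omega>" "finite F" "closure \<Omega> \<subseteq> (\<Union>c\<in>F. ball c (r c))"
    using compactE_image[of "closure \<Omega>" "closure \<Omega>" "\<lambda>c. ball c (r c)"] by auto
  have "\<exists>X. bounded_operator X \<and> (\<forall>f. \<forall>x\<in>\<Omega> \<inter> (\<Union>c\<in>F. ball c (r c)). X f x = f x)"
    using F r by (intro bounded_operator_glue) auto
  moreover have "\<Omega> \<inter> (\<Union>c\<in>F. ball c (r c)) = \<Omega>"
    using F(3) closure_subset[of \<Omega>] by blast
  ultimately show ?thesis using that by auto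
qed

end

section \<open>Measures with bounded densities\<close>

lemma borel_measurable_prob_with_density:
  assumes "prob_with_density U \<nu> \<sigma>"
  shows "borel_measurable \<nu> = borel_measurable (restrict_space lborel U)"
proof (rule measurable_cong_sets)
  have "\<nu> = density (restrict_space lborel U) (\<lambda>x. ennreal (\<sigma> x))"
    using assms by (simp add: prob_with_density_def)
  then show "sets \<nu> = sets (restrict_space lborel U)" by simp
qed simp

lemma nn_integral_prob_with_density:
  assumes U: "U \<in> sets borel" and \<nu>: "prob_with_density U \<nu> \<sigma>" and F: "F \<in> borel_measurable \<nu>"
  shows "(\<integral>\<^sup>+x. F x \<partial>\<nu>) = (\<integral>\<^sup>+x\<in>U. ennreal (\<sigma> x) * F x \<partial>lborel)"
proof -
  have \<nu>_eq: "\<nu> = density (restrict_space lborel U) (\<lambda>x. ennreal (\<sigma> x))"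
    and [measurable]: "\<sigma> \<in> borel_measurable (restrict_space lborel U)"
    using \<nu> by (auto simp: prob_with_density_def)
  have [measurable]: "F \<in> borel_measurable (restrict_space lborel U)"
    using F unfolding borel_measurable_prob_with_density[OF \<nu>] .
  have "(\<integral>\<^sup>+x. F x \<partial>\<nu>) = (\<integral>\<^sup>+x. ennreal (\<sigma> x) * F x \<partial>restrict_space lborel U)"
    unfolding \<nu>_eq by (rule nn_integral_density) measurable
  also have "\<dots> = (\<integral>\<^sup>+x\<in>U. ennreal (\<sigma> x) * F x \<partial>lborel)"
    using U by (intro nn_integral_restrict_space) simp
  finally show ?thesis .
qed

lemma nn_integral_prob_with_density_le:
  assumes U: "U \<in> sets borel" and \<nu>: "prob_with_density U \<nu> \<sigma>"
    and F [measurable]: "F \<in> borel_measurable borel" and \<sigma>: "\<And>x. x \<in> U \<Longrightarrow> \<sigma> x \<le> \<kappa>"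
  shows "(\<integral>\<^sup>+x. F x \<partial>\<nu>) \<le> ennreal \<kappa> * (\<integral>\<^sup>+x\<in>U. F x \<partial>lborel)"
proof -
  have "F \<in> borel_measurable \<nu>"
    unfolding borel_measurable_prob_with_density[OF \<nu>] by (intro measurable_restrict_space1) simp
  then have "(\<integral>\<^sup>+x. F x \<partial>\<nu>) = (\<integral>\<^sup>+x\<in>U. ennreal (\<sigma> x) * F x \<partial>lborel)"
    by (rule nn_integral_prob_with_density[OF U \<nu>])
  also have "\<dots> \<le> (\<integral>\<^sup>+x. ennreal \<kappa> * (F x * indicator U x) \<partial>lborel)"
    using \<sigma> by (intro nn_integral_mono) (auto simp: indicator_def intro!: mult_right_mono ennreal_leI)
  also have "\<dots> = ennreal \<kappa> * (\<integral>\<^sup>+x\<in>U. F x \<partial>lborel)"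
    using U by (intro nn_integral_cmult) simp
  finally show ?thesis .
qed

lemma nn_integral_le_prob_with_density:
  assumes U: "U \<in> sets borel" and \<nu>: "prob_with_density U \<nu> \<sigma>"
    and F: "F \<in> borel_measurable \<nu>" and \<kappa>: "\<kappa> > 0" and \<sigma>: "\<And>x. x \<in> U \<Longrightarrow> 1 / \<kappa> \<le> \<sigma> x"
  shows "(\<integral>\<^sup>+x\<in>U. F x \<partial>lborel) \<le> ennreal \<kappa> * (\<integral>\<^sup>+x. F x \<partial>\<nu>)"
proof -
  have "F \<in> borel_measurable (restrict_space lborel U)"
    using F unfolding borel_measurable_prob_with_density[OF \<nu>] .
  then have [measurable]: "(\<lambda>x. F x * indicator U x) \<in> borel_measurable lborel"
    using U by (subst (asm) borel_measurable_restrict_space_iff_ennreal) auto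
  have "(\<integral>\<^sup>+x\<in>U. F x \<partial>lborel) = ennreal \<kappa> * (ennreal (1 / \<kappa>) * (\<integral>\<^sup>+x\<in>U. F x \<partial>lborel))"
    using \<kappa> by (simp add: mult.assoc[symmetric] ennreal_mult'[symmetric])
  also have "ennreal (1 / \<kappa>) * (\<integral>\<^sup>+x\<in>U. F x \<partial>lborel) = (\<integral>\<^sup>+x. ennreal (1 / \<kappa>) * (F x * indicator U x) \<partial>lborel)"
    by (rule nn_integral_cmult[symmetric]) measurable
  also have "\<dots> \<le> (\<integral>\<^sup>+x\<in>U. ennreal (\<sigma> x) * F x \<partial>lborel)"
    using \<sigma> by (intro nn_integral_mono) (auto simp: indicator_def intro!: mult_right_mono ennreal_leI)
  also have "\<dots> = (\<integral>\<^sup>+x. F x \<partial>\<nu>)"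
    by (rule nn_integral_prob_with_density[OF U \<nu> F, symmetric])
  finally show ?thesis by (simp add: mult_left_mono)
qed

lemma AE_prob_with_density_iff:
  assumes U: "U \<in> sets borel" and \<nu>: "prob_with_density U \<nu> \<sigma>" and \<sigma>: "\<And>x. x \<in> U \<Longrightarrow> \<sigma> x > 0"
  shows "(AE x in \<nu>. P x) \<longleftrightarrow> (AE x in lborel. x \<in> U \<longrightarrow> P x)"
proof -
  have \<nu>_eq: "\<nu> = density (restrict_space lborel U) (\<lambda>x. ennreal (\<sigma> x))"
    and [measurable]: "\<sigma> \<in> borel_measurable (restrict_space lborel U)"
    using \<nu> by (auto simp: prob_with_density_def)
  have "(AE x in \<nu>. P x) \<longleftrightarrow> (AE x in restrict_space lborel U. 0 < ennreal (\<sigma> x) \<longrightarrow> P x)"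
    unfolding \<nu>_eq by (rule AE_density) measurable
  also have "\<dots> \<longleftrightarrow> (AE x in lborel. x \<in> U \<longrightarrow> 0 < ennreal (\<sigma> x) \<longrightarrow> P x)"
    using U by (intro AE_restrict_space_iff) simp
  also have "\<dots> \<longleftrightarrow> (AE x in lborel. x \<in> U \<longrightarrow> P x)"
    using \<sigma> by (intro AE_cong) auto
  finally show ?thesis .
qed

lemma Lp_iff_nn_integral:
  "f \<in> Lp p \<nu> \<longleftrightarrow> f \<in> borel_measurable \<nu> \<and> (\<integral>\<^sup>+x. ennreal (\<bar>f x\<bar> powr p) \<partial>\<nu>) < \<infinity>"
  unfolding Lp_def by (auto simp: integrable_iff_bounded)

lemma Lp_norm_powr:
  assumes "f \<in> Lp p \<nu>" "p \<ge> 1"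
  shows "ennreal (Lp_norm p \<nu> f powr p) = (\<integral>\<^sup>+x. ennreal (\<bar>f x\<bar> powr p) \<partial>\<nu>)"
proof -
  have int: "integrable \<nu> (\<lambda>x. \<bar>f x\<bar> powr p)" using assms by (simp add: Lp_def)
  have "Lp_norm p \<nu> f powr p = (\<integral>x. \<bar>f x\<bar> powr p \<partial>\<nu>)"
    using assms(2) by (simp add: Lp_norm_def powr_powr)
  then show ?thesis using nn_integral_eq_integral[OF int] by simp
qed

lemma Lp_norm_le:
  assumes f: "f \<in> Lp p \<nu>" and g: "g \<in> Lp p \<nu>'" and p: "p \<ge> 1" and c: "c \<ge> 0"
    and le: "(\<integral>\<^sup>+x. ennreal (\<bar>g x\<bar> powr p) \<partial>\<nu>') \<le> ennreal c * (\<integral>\<^sup>+x. ennreal (\<bar>f x\<bar> powr p) \<partial>\<nu>)"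
  shows "Lp_norm p \<nu>' g \<le> c powr (1 / p) * Lp_norm p \<nu> f"
proof -
  have nn: "Lp_norm p \<nu> f \<ge> 0" "Lp_norm p \<nu>' g \<ge> 0" by (simp_all add: Lp_norm_def)
  have "Lp_norm p \<nu>' g powr p \<le> c * Lp_norm p \<nu> f powr p"
    using le c unfolding Lp_norm_powr[OF f p, symmetric] Lp_norm_powr[OF g p, symmetric]
    by (simp add: ennreal_mult'[symmetric])
  then have "(Lp_norm p \<nu>' g powr p) powr (1 / p) \<le> (c * Lp_norm p \<nu> f powr p) powr (1 / p)"
    using p by (intro powr_mono2) auto
  then show ?thesis
    using p c nn by (simp add: powr_mult powr_powr)
qed

context radial_kernel
begin

text \<open>
  In this estimate and the next, \<open>\<theta>\<close> is the kernel of the variation, which may differ from \<open>\<eta>\<close> at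
  negative arguments.
\<close>
lemma nonlocal_variation_le_energy:
  assumes agree: "\<And>t. t \<ge> 0 \<Longrightarrow> \<theta> t = \<eta> t" and \<epsilon>: "\<epsilon> > 0"
    and [measurable]: "U \<in> sets borel" "u \<in> borel_measurable borel"
    and \<sigma>: "\<And>x. x \<in> U \<Longrightarrow> 0 \<le> \<sigma> x \<and> \<sigma> x \<le> \<kappa>" and \<kappa>: "\<kappa> \<ge> 0"
  shows "nonlocal_variation p (scaled_kernel CARD('n) \<theta> \<epsilon>) U \<sigma> u
    \<le> ennreal (\<kappa>\<^sup>2 / \<epsilon> ^ CARD('n)) * energy U \<epsilon> u"
proof -
  define a where "a x y = ennreal (\<eta> (norm (x - y) / \<epsilon>) * \<bar>u x - u y\<bar> powr p) * indicator U y * indicator U x" for x y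
  have [measurable]: "(\<lambda>(x, y). a x y) \<in> borel_measurable (borel \<Otimes>\<^sub>M borel)" "a x \<in> borel_measurable borel" for x
    unfolding a_def by measurable
  let ?c = "ennreal (\<kappa>\<^sup>2 / \<epsilon> ^ CARD('n))"
  have "nonlocal_variation p (scaled_kernel CARD('n) \<theta> \<epsilon>) U \<sigma> u \<le> (\<integral>\<^sup>+x. \<integral>\<^sup>+y. ?c * a x y \<partial>lborel \<partial>lborel)"
    unfolding nonlocal_variation_def
  proof (rule nn_integral_mono)
    fix x
    show "(\<integral>\<^sup>+y\<in>U. ennreal (scaled_kernel CARD('n) \<theta> \<epsilon> (norm (x - y)) * \<bar>u x - u y\<bar> powr p * \<sigma> x * \<sigma> y) \<partial>lborel) * indicator U x
        \<le> (\<integral>\<^sup>+y. ?c * a x y \<partial>lborel)"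
    proof (cases "x \<in> U")
      case True
      have "ennreal (scaled_kernel CARD('n) \<theta> \<epsilon> (norm (x - y)) * \<bar>u x - u y\<bar> powr p * \<sigma> x * \<sigma> y) * indicator U y
          \<le> ?c * a x y" for y
      proof (cases "y \<in> U")
        case y: True
        have "\<sigma> x * \<sigma> y \<le> \<kappa> * \<kappa>"
          using \<sigma>[OF True] \<sigma>[OF y] \<kappa> by (intro mult_mono) auto
        then have "scaled_kernel CARD('n) \<theta> \<epsilon> (norm (x - y)) * \<bar>u x - u y\<bar> powr p * (\<sigma> x * \<sigma> y)
            \<le> scaled_kernel CARD('n) \<theta> \<epsilon> (norm (x - y)) * \<bar>u x - u y\<bar> powr p * (\<kappa> * \<kappa>)"
          using \<epsilon> kernel_nonneg by (intro mult_left_mono) (auto simp: scaled_kernel_def agree)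
        also have "\<dots> = \<kappa>\<^sup>2 / \<epsilon> ^ CARD('n) * (\<eta> (norm (x - y) / \<epsilon>) * \<bar>u x - u y\<bar> powr p)"
          using \<epsilon> by (simp add: scaled_kernel_def agree power2_eq_square)
        finally show ?thesis
          using True y \<epsilon> by (simp add: a_def ennreal_mult'[symmetric] mult.assoc ennreal_leI)
      qed simp
      then show ?thesis using True by (auto intro: nn_integral_mono)
    qed simp
  qed
  also have "\<dots> = ?c * (\<integral>\<^sup>+x. \<integral>\<^sup>+y. a x y \<partial>lborel \<partial>lborel)"
    by (simp add: nn_integral_cmult)
  also have "(\<integral>\<^sup>+x. \<integral>\<^sup>+y. a x y \<partial>lborel \<partial>lborel) = energy U \<epsilon> u"
    unfolding energy_def a_def by (simp add: nn_integral_multc)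
  finally show ?thesis .
qed

text \<open>
  Since \<open>\<sigma>\<close> need not be measurable off \<open>U\<close>, constants are moved only through the integrals of the
  energy, whose integrand is Borel.
\<close>
lemma energy_le_nonlocal_variation:
  assumes agree: "\<And>t. t \<ge> 0 \<Longrightarrow> \<theta> t = \<eta> t" and \<epsilon>: "\<epsilon> > 0"
    and [measurable]: "U \<in> sets borel" "u \<in> borel_measurable borel"
    and \<sigma>: "\<And>x. x \<in> U \<Longrightarrow> 1 / \<kappa> \<le> \<sigma> x" and \<kappa>: "\<kappa> > 0"
  shows "energy U \<epsilon> u
    \<le> ennreal (\<kappa>\<^sup>2 * \<epsilon> ^ CARD('n)) * nonlocal_variation p (scaled_kernel CARD('n) \<theta> \<epsilon>) U \<sigma> u"
proof -
  define a where "a x y = ennreal (\<eta> (norm (x - y) / \<epsilon>) * \<bar>u x - u y\<bar> powr p) * indicator U y * indicator U x" for x y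
  have [measurable]: "(\<lambda>(x, y). a x y) \<in> borel_measurable (borel \<Otimes>\<^sub>M borel)" "a x \<in> borel_measurable borel" for x
    unfolding a_def by measurable
  let ?c = "ennreal (1 / (\<kappa>\<^sup>2 * \<epsilon> ^ CARD('n)))"
  have "(\<integral>\<^sup>+x. \<integral>\<^sup>+y. ?c * a x y \<partial>lborel \<partial>lborel) \<le> nonlocal_variation p (scaled_kernel CARD('n) \<theta> \<epsilon>) U \<sigma> u"
    unfolding nonlocal_variation_def
  proof (rule nn_integral_mono)
    fix x
    show "(\<integral>\<^sup>+y. ?c * a x y \<partial>lborel)
        \<le> (\<integral>\<^sup>+y\<in>U. ennreal (scaled_kernel CARD('n) \<theta> \<epsilon> (norm (x - y)) * \<bar>u x - u y\<bar> powr p * \<sigma> x * \<sigma> y) \<partial>lborel) * indicator U x"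
    proof (cases "x \<in> U")
      case True
      have "?c * a x y \<le> ennreal (scaled_kernel CARD('n) \<theta> \<epsilon> (norm (x - y)) * \<bar>u x - u y\<bar> powr p * \<sigma> x * \<sigma> y) * indicator U y" for y
      proof (cases "y \<in> U")
        case y: True
        have "1 / \<kappa> * (1 / \<kappa>) \<le> \<sigma> x * \<sigma> y"
          using \<sigma>[OF True] \<sigma>[OF y] \<kappa> by (intro mult_mono) (auto intro: order_trans[of _ "1 / \<kappa>"])
        then have "scaled_kernel CARD('n) \<theta> \<epsilon> (norm (x - y)) * \<bar>u x - u y\<bar> powr p * (1 / \<kappa> * (1 / \<kappa>))
            \<le> scaled_kernel CARD('n) \<theta> \<epsilon> (norm (x - y)) * \<bar>u x - u y\<bar> powr p * (\<sigma> x * \<sigma> y)"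
          using \<epsilon> kernel_nonneg by (intro mult_left_mono) (auto simp: scaled_kernel_def agree)
        moreover have "scaled_kernel CARD('n) \<theta> \<epsilon> (norm (x - y)) * \<bar>u x - u y\<bar> powr p * (1 / \<kappa> * (1 / \<kappa>))
            = 1 / (\<kappa>\<^sup>2 * \<epsilon> ^ CARD('n)) * (\<eta> (norm (x - y) / \<epsilon>) * \<bar>u x - u y\<bar> powr p)"
          using \<epsilon> by (simp add: scaled_kernel_def agree power2_eq_square)
        ultimately have "1 / (\<kappa>\<^sup>2 * \<epsilon> ^ CARD('n)) * (\<eta> (norm (x - y) / \<epsilon>) * \<bar>u x - u y\<bar> powr p)
            \<le> scaled_kernel CARD('n) \<theta> \<epsilon> (norm (x - y)) * \<bar>u x - u y\<bar> powr p * \<sigma> x * \<sigma> y"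
          by (simp only: mult.assoc)
        from ennreal_leI[OF this] show ?thesis
          using True y \<epsilon> unfolding a_def by (subst (asm) ennreal_mult') simp_all
      qed (simp add: a_def)
      then show ?thesis using True by (auto intro: nn_integral_mono)
    qed (simp add: a_def)
  qed
  also have "(\<integral>\<^sup>+x. \<integral>\<^sup>+y. ?c * a x y \<partial>lborel \<partial>lborel) = ?c * (\<integral>\<^sup>+x. \<integral>\<^sup>+y. a x y \<partial>lborel \<partial>lborel)"
    by (simp add: nn_integral_cmult)
  also have "(\<integral>\<^sup>+x. \<integral>\<^sup>+y. a x y \<partial>lborel \<partial>lborel) = energy U \<epsilon> u"
    unfolding energy_def a_def by (simp add: nn_integral_multc)
  finally have "ennreal (\<kappa>\<^sup>2 * \<epsilon> ^ CARD('n)) * (?c * energy U \<epsilon> u)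
      \<le> ennreal (\<kappa>\<^sup>2 * \<epsilon> ^ CARD('n)) * nonlocal_variation p (scaled_kernel CARD('n) \<theta> \<epsilon>) U \<sigma> u"
    by (rule mult_left_mono) simp
  moreover have "ennreal (\<kappa>\<^sup>2 * \<epsilon> ^ CARD('n)) * (?c * energy U \<epsilon> u) = energy U \<epsilon> u"
    using \<kappa> \<epsilon> by (simp add: mult.assoc[symmetric] ennreal_mult'[symmetric])
  ultimately show ?thesis by simp
qed

end

section \<open>The extension theorem\<close>

theorem lemma5p1:
  fixes \<Omega> :: "(real ^ 'n) set" and \<mu> :: "(real ^ 'n) measure" and \<rho> :: "real ^ 'n \<Rightarrow> real"
    and \<eta> :: "real \<Rightarrow> real" and p :: real
  assumes "open \<Omega>" and "bounded \<Omega>" and "lipschitz_boundary \<Omega>"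
    and "prob_with_density \<Omega> \<mu> \<rho>" and "continuous_on \<Omega> \<rho>"
    and "\<forall>r\<ge>0. 0 \<le> \<eta> r"
    and "p \<ge> 1"
    and "continuous (at 0 within {0..}) \<eta>" and "antimono_on {0..} \<eta>" and "\<eta> 0 > 0"
    and "\<exists>D>0. \<forall>x\<in>\<Omega>. 1 / D \<le> \<rho> x \<and> \<rho> x \<le> D"
    and "\<exists>q>p. kernel_moment CARD('n) \<eta> q < \<infinity>"
  shows "\<exists>(\<Sigma> :: (real ^ 'n) set) (\<delta> :: real) (\<mu>' :: (real ^ 'n) measure) (\<rho>' :: real ^ 'n \<Rightarrow> real)
           (X :: (real ^ 'n \<Rightarrow> real) \<Rightarrow> real ^ 'n \<Rightarrow> real).
      (open \<Sigma> \<and> \<Omega> \<subseteq> \<Sigma> \<and> \<delta> > 0 \<and> (\<Union>x\<in>\<Omega>. ball x \<delta>) \<subseteq> \<Sigma>) \<and>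
      (prob_with_density \<Sigma> \<mu>' \<rho>' \<and>
       (\<exists>\<kappa>>0. \<forall>x\<in>\<Sigma>. 1 / \<kappa> \<le> \<rho>' x \<and> \<rho>' x \<le> \<kappa>) \<and>
       (\<exists>c>0. \<forall>x\<in>\<Omega>. \<rho>' x = c * \<rho> x)) \<and>
      (Lp_extension_operator p \<mu> \<mu>' X \<and>
       (\<exists>(A :: real) (B :: real) (C :: real). A > 0 \<and> B \<ge> 1 \<and> C > 0 \<and>
          (\<forall>\<epsilon>>0. \<forall>f\<in>Lp p \<mu>.
             ennreal (1 / \<epsilon> powr p) *
               nonlocal_variation p (scaled_kernel CARD('n) \<eta> \<epsilon>) \<Sigma> \<rho>' (X f)
             \<le> ennreal A * (ennreal (Lp_norm p \<mu> f powr p) +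
                 ennreal (1 / (B powr p * \<epsilon> powr p)) *
                   nonlocal_variation p (scaled_kernel CARD('n) \<eta> (B * \<epsilon>)) \<Omega> \<rho> f)) \<and>
          (\<forall>f\<in>Lp p \<mu>. Lp_norm p \<mu>' (X f) \<le> C * Lp_norm p \<mu> f)))"
proof -
  note \<mu> = assms(4) and p = assms(7)
  obtain D where D: "D > 0" and \<rho>_low: "\<And>x. x \<in> \<Omega> \<Longrightarrow> 1 / D \<le> \<rho> x" and \<rho>_up: "\<And>x. x \<in> \<Omega> \<Longrightarrow> \<rho> x \<le> D"
    using assms(11) by blast
  obtain q where q: "p < q" "kernel_moment CARD('n) \<eta> q < \<infinity>"
    using assms(12) by blast
  have \<rho>_pos: "\<rho> x > 0" if "x \<in> \<Omega>" for x
    using \<rho>_low[OF that] D by (meson divide_pos_pos less_le_trans zero_less_one)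

  \<comment> \<open>Constant continuation of the kernel to negative arguments.\<close>
  define \<theta> where "\<theta> t = \<eta> (max 0 t)" for t
  have \<theta>_nonneg: "0 \<le> \<theta> t" for t using assms(6) by (simp add: \<theta>_def)
  have \<theta>_anti: "antimono \<theta>"
    unfolding \<theta>_def using assms(9) by (intro antimonoI) (auto simp: monotone_on_def max_def)
  have "kernel_moment CARD('n) \<theta> q = kernel_moment CARD('n) \<eta> q"
    unfolding kernel_moment_def by (intro nn_integral_cong) (auto simp: \<theta>_def indicator_def)
  then have \<theta>_moment: "kernel_moment DIM(real ^ 'n) \<theta> q < \<infinity>"
    using q(2) by simp
  interpret radial_kernel \<Omega> \<theta> p
    using radial_moment_finite[OF \<theta>_nonneg \<theta>_anti p q(1) \<theta>_moment] p \<theta>_nonneg \<theta>_anti assms(1)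
    by unfold_locales auto
  have agree: "\<eta> t = \<theta> t" if "t \<ge> 0" for t using that by (simp add: \<theta>_def)
  obtain X where X: "bounded_operator X" and X_ext: "\<And>f x. x \<in> \<Omega> \<Longrightarrow> X f x = f x"
    using bounded_extension_exists[OF assms(1,2,3)] by blast
  obtain a B where a: "a < \<infinity>" and B: "B \<ge> 1"
    and X_mass: "\<And>f. f \<in> borel_measurable borel \<Longrightarrow> mass UNIV (X f) \<le> a * mass \<Omega> f"
    and X_energy: "\<And>f \<epsilon>. f \<in> borel_measurable borel \<Longrightarrow> \<epsilon> > 0 \<Longrightarrow> ennreal (weight \<epsilon>) * energy UNIV \<epsilon> (X f)
           \<le> a * (mass \<Omega> f + ennreal (weight \<epsilon>) * energy \<Omega> (B * \<epsilon>) f)"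
    using bounded_operatorE[OF X] by blast
  define A where "A = enn2real a"
  have aA: "a = ennreal A" "A \<ge> 0" using a by (simp_all add: A_def)

  obtain M where M: "\<Omega> \<subseteq> ball 0 M"
    using assms(2) bounded_subset_ballD[of \<Omega> 0] by blast
  define \<Sigma> where "\<Sigma> = ball (0 :: real ^ 'n) (M + 1)"
  have \<Sigma>_sub: "\<Omega> \<subseteq> \<Sigma>" using M by (force simp: \<Sigma>_def)
  have nbhd: "(\<Union>x\<in>\<Omega>. ball x 1) \<subseteq> \<Sigma>"
  proof
    fix y assume "y \<in> (\<Union>x\<in>\<Omega>. ball x 1)"
    then obtain x where "x \<in> \<Omega>" "dist x y < 1" by auto
    then show "y \<in> \<Sigma>"
      using M dist_triangle[of 0 y x] by (force simp: \<Sigma>_def)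
  qed
  have \<Sigma>_borel [measurable]: "\<Sigma> \<in> sets borel" by (simp add: \<Sigma>_def)

  \<comment> \<open>The density \<open>\<rho>\<close> is continued by one to \<open>\<Sigma>\<close>, and \<open>Z\<close> is the total mass of the result.\<close>
  define Z where "Z = 1 + measure lborel (\<Sigma> - \<Omega>)"
  have Z: "Z \<ge> 1" by (simp add: Z_def)
  have Z_eq: "ennreal Z = 1 + emeasure lborel (\<Sigma> - \<Omega>)"
  proof -
    have "emeasure lborel (\<Sigma> - \<Omega>) \<le> emeasure lborel \<Sigma>"
      by (intro emeasure_mono) auto
    also have "\<dots> < \<infinity>" unfolding \<Sigma>_def by (rule emeasure_lborel_ball_finite)
    finally show ?thesis
      unfolding Z_def by (subst ennreal_plus) (auto simp: emeasure_eq_ennreal_measure)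
  qed
  define \<rho>' where "\<rho>' x = (if x \<in> \<Omega> then \<rho> x else 1) / Z" for x
  define \<mu>' where "\<mu>' = density (restrict_space lborel \<Sigma>) (\<lambda>x. ennreal (\<rho>' x))"
  define \<kappa> where "\<kappa> = Z * (D + 1)"
  have \<kappa>: "\<kappa> > 0" using Z D by (simp add: \<kappa>_def)
  have \<rho>'_low: "1 / \<kappa> \<le> \<rho>' x" for x
  proof -
    have "1 / (D + 1) \<le> (if x \<in> \<Omega> then \<rho> x else 1)"
      using D \<rho>_low[of x] frac_le[of 1 1 D "D + 1"] by auto
    then have "1 / (D + 1) / Z \<le> \<rho>' x"
      unfolding \<rho>'_def using Z by (intro divide_right_mono) auto
    then show ?thesis by (simp add: \<kappa>_def mult.commute)
  qed
  have \<rho>'_up: "\<rho>' x \<le> \<kappa>" for x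
  proof -
    have "\<rho>' x \<le> (D + 1) / Z"
      unfolding \<rho>'_def using Z D \<rho>_up[of x] by (intro divide_right_mono) auto
    also have "\<dots> \<le> (D + 1) / 1"
      using Z D by (intro divide_left_mono) auto
    also have "\<dots> \<le> \<kappa>" using mult_right_mono[OF Z, of "D + 1"] D by (simp add: \<kappa>_def)
    finally show ?thesis .
  qed
  have \<rho>'_pos: "\<rho>' x > 0" for x
    using \<rho>'_low[of x] \<kappa> by (meson divide_pos_pos less_le_trans zero_less_one)
  have \<rho>_borel [measurable]: "(\<lambda>x. indicator \<Omega> x * \<rho> x) \<in> borel_measurable borel"
    using \<mu> borel_measurable_restrict_space_iff[of \<Omega> lborel \<rho>] by (simp add: prob_with_density_def)
  have \<rho>'_borel [measurable]: "\<rho>' \<in> borel_measurable borel"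
  proof -
    have "\<rho>' = (\<lambda>x. (indicator \<Omega> x * \<rho> x + indicator (- \<Omega>) x) / Z)"
      by (auto simp: \<rho>'_def indicator_def)
    also have "\<dots> \<in> borel_measurable borel" by measurable
    finally show ?thesis .
  qed
  have \<mu>_total: "(\<integral>\<^sup>+x\<in>\<Omega>. ennreal (\<rho> x) \<partial>lborel) = 1"
  proof -
    interpret \<mu>: prob_space \<mu> using \<mu> unfolding prob_with_density_def by (rule conjunct1)
    have "(\<integral>\<^sup>+x\<in>\<Omega>. ennreal (\<rho> x) * 1 \<partial>lborel) = (\<integral>\<^sup>+x. 1 \<partial>\<mu>)"
      by (rule nn_integral_prob_with_density[OF domain_borel \<mu>, symmetric]) simp
    then show ?thesis by (simp add: \<mu>.emeasure_space_1)
  qed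
  have \<rho>'_total: "(\<integral>\<^sup>+x\<in>\<Sigma>. ennreal (\<rho>' x) \<partial>lborel) = 1"
  proof -
    have "(\<integral>\<^sup>+x\<in>\<Sigma>. ennreal (\<rho>' x) \<partial>lborel)
        = (\<integral>\<^sup>+x. ennreal (1 / Z) * (ennreal (indicator \<Omega> x * \<rho> x) + indicator (\<Sigma> - \<Omega>) x) \<partial>lborel)"
    proof (rule nn_integral_cong)
      fix x
      show "ennreal (\<rho>' x) * indicator \<Sigma> x
          = ennreal (1 / Z) * (ennreal (indicator \<Omega> x * \<rho> x) + indicator (\<Sigma> - \<Omega>) x)"
        using \<Sigma>_sub Z by (cases "x \<in> \<Omega>"; cases "x \<in> \<Sigma>")
          (auto simp: \<rho>'_def ennreal_mult'[symmetric])
    qed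
    also have "\<dots> = ennreal (1 / Z) * ((\<integral>\<^sup>+x. ennreal (indicator \<Omega> x * \<rho> x) \<partial>lborel) + emeasure lborel (\<Sigma> - \<Omega>))"
      by (simp add: nn_integral_cmult nn_integral_add)
    also have "(\<integral>\<^sup>+x. ennreal (indicator \<Omega> x * \<rho> x) \<partial>lborel) = (\<integral>\<^sup>+x\<in>\<Omega>. ennreal (\<rho> x) \<partial>lborel)"
      by (intro nn_integral_cong) (auto simp: indicator_def)
    also have "ennreal (1 / Z) * (\<dots> + emeasure lborel (\<Sigma> - \<Omega>)) = ennreal (1 / Z) * ennreal Z"
      unfolding \<mu>_total Z_eq by simp
    also have "\<dots> = 1" using Z by (simp add: ennreal_mult'[symmetric])
    finally show ?thesis .
  qed
  have \<rho>'_restrict: "\<rho>' \<in> borel_measurable (restrict_space lborel \<Sigma>)"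
    by (intro measurable_restrict_space1) simp
  have "emeasure \<mu>' (space \<mu>') = (\<integral>\<^sup>+x. 1 \<partial>\<mu>')" by simp
  also have "\<dots> = (\<integral>\<^sup>+x. ennreal (\<rho>' x) * 1 \<partial>restrict_space lborel \<Sigma>)"
    unfolding \<mu>'_def using \<rho>'_restrict by (intro nn_integral_density) auto
  also have "\<dots> = (\<integral>\<^sup>+x\<in>\<Sigma>. ennreal (\<rho>' x) * 1 \<partial>lborel)"
    by (intro nn_integral_restrict_space) simp
  finally have "prob_space \<mu>'"
    using \<rho>'_total by (intro prob_spaceI) simp
  then have \<mu>': "prob_with_density \<Sigma> \<mu>' \<rho>'"
    unfolding prob_with_density_def
    using \<rho>'_restrict \<rho>'_pos by (auto simp: \<mu>'_def intro: less_imp_le)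

  \<comment> \<open>Elements of the Lebesgue space of \<open>\<mu>\<close> have arbitrary values off \<open>\<Omega>\<close>; setting these to zero makes
    them Borel on the whole space.\<close>
  define ext where "ext f = (\<lambda>x. indicator \<Omega> x * f x)" for f :: "real ^ 'n \<Rightarrow> real"
  have ext_borel: "ext f \<in> borel_measurable borel" if "f \<in> Lp p \<mu>" for f
  proof -
    have "f \<in> borel_measurable (restrict_space lborel \<Omega>)"
      using that unfolding Lp_def borel_measurable_prob_with_density[OF \<mu>] by simp
    then show ?thesis
      using borel_measurable_restrict_space_iff[of \<Omega> lborel f] by (simp add: ext_def)
  qed
  define norm_p where "norm_p f = (\<integral>\<^sup>+x. ennreal (\<bar>f x\<bar> powr p) \<partial>\<mu>)" for f
  have mass_ext: "mass \<Omega> (ext f) \<le> ennreal D * norm_p f" if "f \<in> Lp p \<mu>" for f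
  proof -
    have "mass \<Omega> (ext f) = (\<integral>\<^sup>+x\<in>\<Omega>. ennreal (\<bar>f x\<bar> powr p) \<partial>lborel)"
      unfolding mass_def ext_def by (intro nn_integral_cong) (auto simp: indicator_def)
    also have "\<dots> \<le> ennreal D * norm_p f"
      unfolding norm_p_def using that D \<rho>_low
      by (intro nn_integral_le_prob_with_density[OF domain_borel \<mu>]) (auto simp: Lp_def)
    finally show ?thesis .
  qed
  have norm_X: "(\<integral>\<^sup>+x. ennreal (\<bar>X (ext f) x\<bar> powr p) \<partial>\<mu>') \<le> ennreal (\<kappa> * A * D) * norm_p f"
    if f: "f \<in> Lp p \<mu>" for f
  proof -
    have [measurable]: "X (ext f) \<in> borel_measurable borel"
      by (rule bounded_operatorD(1)[OF X ext_borel[OF f]])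
    have "(\<integral>\<^sup>+x. ennreal (\<bar>X (ext f) x\<bar> powr p) \<partial>\<mu>') \<le> ennreal \<kappa> * mass \<Sigma> (X (ext f))"
      unfolding mass_def using \<rho>'_up by (intro nn_integral_prob_with_density_le[OF \<Sigma>_borel \<mu>']) auto
    also have "\<dots> \<le> ennreal \<kappa> * mass UNIV (X (ext f))"
      unfolding mass_def by (intro mult_left_mono nn_integral_mono) (auto simp: indicator_def)
    also have "\<dots> \<le> ennreal \<kappa> * (a * (ennreal D * norm_p f))"
      by (intro mult_left_mono order_trans[OF X_mass[OF ext_borel[OF f]]] mass_ext f) auto
    also have "\<dots> = ennreal (\<kappa> * A * D) * norm_p f"
      using \<kappa> D aA by (simp add: ennreal_mult mult.assoc)
    finally show ?thesis .
  qed
  have X_Lp: "X (ext f) \<in> Lp p \<mu>'" if f: "f \<in> Lp p \<mu>" for f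
  proof -
    have "X (ext f) \<in> borel_measurable \<mu>'"
      unfolding borel_measurable_prob_with_density[OF \<mu>']
      by (intro measurable_restrict_space1) (use bounded_operatorD(1)[OF X ext_borel[OF f]] in simp)
    moreover have "norm_p f < \<infinity>" using f by (simp add: Lp_iff_nn_integral norm_p_def)
    then have "ennreal (\<kappa> * A * D) * norm_p f < \<infinity>" by (simp add: ennreal_mult_less_top)
    ultimately show ?thesis
      using norm_X[OF f] by (auto simp: Lp_iff_nn_integral intro: le_less_trans)
  qed

  have X_cong: "AE x in \<mu>'. X (ext f) x = X (ext g) x"
    if f: "f \<in> Lp p \<mu>" and g: "g \<in> Lp p \<mu>" and fg: "AE x in \<mu>. f x = g x" for f g
  proof -
    \<comment> \<open>By linearity the difference is the image of a function with zero mass, which has zero mass.\<close>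
    define h where "h x = ext f x + (- 1) * ext g x" for x
    have h_borel [measurable]: "h \<in> borel_measurable borel"
      unfolding h_def using ext_borel[OF f] ext_borel[OF g] by measurable
    have [measurable]: "X h \<in> borel_measurable borel" by (rule bounded_operatorD(1)[OF X h_borel])
    have "AE x in lborel. x \<in> \<Omega> \<longrightarrow> f x = g x"
      using fg AE_prob_with_density_iff[OF domain_borel \<mu> \<rho>_pos] by simp
    then have "mass \<Omega> h = (\<integral>\<^sup>+x. 0 \<partial>(lborel :: (real ^ 'n) measure))"
      unfolding mass_def by (intro nn_integral_cong_AE) (auto simp: h_def ext_def indicator_def)
    then have "mass UNIV (X h) = 0" using X_mass[OF h_borel] by simp
    then have "AE x in lborel. X h x = 0"
      unfolding mass_def by (simp add: nn_integral_0_iff_AE)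
    moreover have "X h x = X (ext f) x + (- 1) * X (ext g) x" for x
      unfolding h_def by (simp only: bounded_operatorD(2,3)[OF X])
    ultimately have "AE x in lborel. x \<in> \<Sigma> \<longrightarrow> X (ext f) x = X (ext g) x"
      by (auto elim: eventually_mono)
    then show ?thesis
      using AE_prob_with_density_iff[OF \<Sigma>_borel \<mu>' \<rho>'_pos] by simp
  qed
  have X_add: "X (ext (\<lambda>y. f y + g y)) x = X (ext f) x + X (ext g) x" for f g x
  proof -
    have "ext (\<lambda>y. f y + g y) = (\<lambda>x. ext f x + ext g x)" by (simp add: ext_def algebra_simps)
    then show ?thesis by (simp only: bounded_operatorD(2)[OF X])
  qed
  have X_scale: "X (ext (\<lambda>y. c * f y)) x = c * X (ext f) x" for c f x
  proof -
    have "ext (\<lambda>y. c * f y) = (\<lambda>x. c * ext f x)" by (simp add: ext_def algebra_simps)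
    then show ?thesis by (simp only: bounded_operatorD(3)[OF X])
  qed
  have X_id: "AE x in \<mu>. X (ext f) x = f x" for f
    using AE_prob_with_density_iff[OF domain_borel \<mu> \<rho>_pos] X_ext by (simp add: ext_def)
  have operator: "Lp_extension_operator p \<mu> \<mu>' (\<lambda>f. X (ext f))"
    unfolding Lp_extension_operator_def using X_Lp X_cong X_add X_scale X_id by simp

  \<comment> \<open>\<open>D\<close> bounds the mass by the norm; \<open>D\<^sup>2\<close> does the same for the energy, and the powers of \<open>B\<close> are the
    ratio of the normalisations at the scales \<open>\<epsilon>\<close> and \<open>B * \<epsilon>\<close>.\<close>
  define G where "G = D + D\<^sup>2 * B ^ CARD('n) * B powr p"
  have G: "G > 0" using D B by (simp add: G_def add_pos_nonneg)
  have variation: "ennreal (1 / \<epsilon> powr p) *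
        nonlocal_variation p (scaled_kernel CARD('n) \<eta> \<epsilon>) \<Sigma> \<rho>' (X (ext f))
      \<le> ennreal (\<kappa>\<^sup>2 * A * G + 1) * (ennreal (Lp_norm p \<mu> f powr p) +
          ennreal (1 / (B powr p * \<epsilon> powr p)) *
            nonlocal_variation p (scaled_kernel CARD('n) \<eta> (B * \<epsilon>)) \<Omega> \<rho> f)"
    if \<epsilon>: "\<epsilon> > 0" and f: "f \<in> Lp p \<mu>" for \<epsilon> f
  proof -
    let ?V = "nonlocal_variation p (scaled_kernel CARD('n) \<eta> (B * \<epsilon>)) \<Omega> \<rho> f"
    let ?v = "ennreal (1 / (B powr p * \<epsilon> powr p)) * ?V"
    have f_borel: "ext f \<in> borel_measurable borel" by (rule ext_borel[OF f])
    have Xf_borel: "X (ext f) \<in> borel_measurable borel" by (rule bounded_operatorD(1)[OF X f_borel])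
    have B\<epsilon>: "B * \<epsilon> > 0" using B \<epsilon> by simp
    have "ennreal (1 / \<epsilon> powr p) * nonlocal_variation p (scaled_kernel CARD('n) \<eta> \<epsilon>) \<Sigma> \<rho>' (X (ext f))
        \<le> ennreal (1 / \<epsilon> powr p) * (ennreal (\<kappa>\<^sup>2 / \<epsilon> ^ CARD('n)) * energy \<Sigma> \<epsilon> (X (ext f)))"
      using agree \<epsilon> Xf_borel \<rho>'_pos \<rho>'_up \<kappa>
      by (intro mult_left_mono nonlocal_variation_le_energy) (auto intro: less_imp_le)
    also have "\<dots> = ennreal (\<kappa>\<^sup>2) * (ennreal (weight \<epsilon>) * energy \<Sigma> \<epsilon> (X (ext f)))"
      using \<epsilon> \<kappa> by (simp add: weight_def mult.assoc[symmetric] ennreal_mult'[symmetric])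
    also have "\<dots> \<le> ennreal (\<kappa>\<^sup>2) * (ennreal (weight \<epsilon>) * energy UNIV \<epsilon> (X (ext f)))"
      unfolding energy_def by (intro mult_left_mono nn_integral_mono mult_mono) (auto intro!: nn_integral_mono simp: indicator_def)
    also have "\<dots> \<le> ennreal (\<kappa>\<^sup>2) * (a * (mass \<Omega> (ext f) + ennreal (weight \<epsilon>) * energy \<Omega> (B * \<epsilon>) (ext f)))"
      by (intro mult_left_mono X_energy f_borel \<epsilon>) simp
    also have "\<dots> \<le> ennreal (\<kappa>\<^sup>2) * (a * (ennreal D * norm_p f + ennreal (D\<^sup>2 * B ^ CARD('n) * B powr p) * ?v))"
    proof (intro mult_left_mono add_mono mass_ext f)
      have "energy \<Omega> (B * \<epsilon>) (ext f) \<le> ennreal (D\<^sup>2 * (B * \<epsilon>) ^ CARD('n)) *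
          nonlocal_variation p (scaled_kernel CARD('n) \<eta> (B * \<epsilon>)) \<Omega> \<rho> (ext f)"
        by (rule energy_le_nonlocal_variation[OF agree B\<epsilon> domain_borel f_borel \<rho>_low D])
      also have "nonlocal_variation p (scaled_kernel CARD('n) \<eta> (B * \<epsilon>)) \<Omega> \<rho> (ext f) = ?V"
        unfolding nonlocal_variation_def ext_def
        by (intro nn_integral_cong) (auto simp: indicator_def intro!: nn_integral_cong)
      finally have "ennreal (weight \<epsilon>) * energy \<Omega> (B * \<epsilon>) (ext f)
          \<le> ennreal (weight \<epsilon>) * (ennreal (D\<^sup>2 * (B * \<epsilon>) ^ CARD('n)) * ?V)"
        by (rule mult_left_mono) simp
      also have "\<dots> = ennreal (D\<^sup>2 * B ^ CARD('n) * B powr p) * ?v"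
      proof -
        have "weight \<epsilon> * (D\<^sup>2 * (B * \<epsilon>) ^ CARD('n))
            = (D\<^sup>2 * B ^ CARD('n) * B powr p) * (1 / (B powr p * \<epsilon> powr p))"
          using \<epsilon> B by (simp add: weight_def power_mult_distrib)
        then show ?thesis
          using \<epsilon> B D weight_pos[OF \<epsilon>] by (simp only: mult.assoc[symmetric] ennreal_mult'[symmetric] less_imp_le
              zero_le_power2 zero_le_power mult_nonneg_nonneg powr_ge_zero)
      qed
      finally show "ennreal (weight \<epsilon>) * energy \<Omega> (B * \<epsilon>) (ext f) \<le> ennreal (D\<^sup>2 * B ^ CARD('n) * B powr p) * ?v" .
    qed auto
    also have "\<dots> \<le> ennreal (\<kappa>\<^sup>2) * (a * (ennreal G * (norm_p f + ?v)))"
    proof (intro mult_left_mono)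
      have "ennreal G = ennreal D + ennreal (D\<^sup>2 * B ^ CARD('n) * B powr p)"
        unfolding G_def using D B by (intro ennreal_plus) auto
      then show "ennreal D * norm_p f + ennreal (D\<^sup>2 * B ^ CARD('n) * B powr p) * ?v \<le> ennreal G * (norm_p f + ?v)"
        by (simp only: ennreal_combine_le)
    qed auto
    also have "\<dots> = ennreal (\<kappa>\<^sup>2 * A * G) * (norm_p f + ?v)"
      using aA G by (simp add: ennreal_mult mult.assoc)
    also have "\<dots> \<le> ennreal (\<kappa>\<^sup>2 * A * G + 1) * (norm_p f + ?v)"
      by (intro mult_right_mono ennreal_leI) auto
    also have "norm_p f = ennreal (Lp_norm p \<mu> f powr p)"
      unfolding norm_p_def by (rule Lp_norm_powr[OF f p, symmetric])
    finally show ?thesis .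
  qed
  define C where "C = (\<kappa> * A * D) powr (1 / p) + 1"
  have bound: "Lp_norm p \<mu>' (X (ext f)) \<le> C * Lp_norm p \<mu> f" if f: "f \<in> Lp p \<mu>" for f
  proof -
    have "Lp_norm p \<mu>' (X (ext f)) \<le> (\<kappa> * A * D) powr (1 / p) * Lp_norm p \<mu> f"
      using norm_X[OF f] \<kappa> aA D unfolding norm_p_def by (intro Lp_norm_le f X_Lp p) auto
    also have "\<dots> \<le> C * Lp_norm p \<mu> f"
      by (intro mult_right_mono) (auto simp: C_def Lp_norm_def)
    finally show ?thesis .
  qed
  \<comment> \<open>Adding one makes the constants positive even if \<open>A = 0\<close>.\<close>
  have constants: "\<kappa>\<^sup>2 * A * G + 1 > 0" "C > 0"
    using aA G by (auto simp: C_def intro!: add_nonneg_pos)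
  have estimates: "\<exists>A B C. A > 0 \<and> B \<ge> 1 \<and> C > 0 \<and>
      (\<forall>\<epsilon>>0. \<forall>f\<in>Lp p \<mu>. ennreal (1 / \<epsilon> powr p) *
         nonlocal_variation p (scaled_kernel CARD('n) \<eta> \<epsilon>) \<Sigma> \<rho>' (X (ext f))
         \<le> ennreal A * (ennreal (Lp_norm p \<mu> f powr p) + ennreal (1 / (B powr p * \<epsilon> powr p)) *
             nonlocal_variation p (scaled_kernel CARD('n) \<eta> (B * \<epsilon>)) \<Omega> \<rho> f)) \<and>
      (\<forall>f\<in>Lp p \<mu>. Lp_norm p \<mu>' (X (ext f)) \<le> C * Lp_norm p \<mu> f)"
    by (intro exI[of _ "\<kappa>\<^sup>2 * A * G + 1"] exI[of _ B] exI[of _ C] conjI allI ballI impI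
        constants B variation bound)
  have proportional: "\<exists>c>0. \<forall>x\<in>\<Omega>. \<rho>' x = c * \<rho> x"
    using Z by (intro exI[of _ "1 / Z"]) (auto simp: \<rho>'_def)
  have bounds: "\<exists>\<kappa>>0. \<forall>x\<in>\<Sigma>. 1 / \<kappa> \<le> \<rho>' x \<and> \<rho>' x \<le> \<kappa>"
    using \<kappa> \<rho>'_low \<rho>'_up by blast
  have open_\<Sigma>: "open \<Sigma>" by (simp add: \<Sigma>_def)
  show ?thesis
    by (rule exI[of _ \<Sigma>], rule exI[of _ 1], rule exI[of _ \<mu>'], rule exI[of _ \<rho>'],
        rule exI[of _ "\<lambda>f. X (ext f)"])
      (intro conjI open_\<Sigma> \<Sigma>_sub zero_less_one nbhd \<mu>' bounds proportional operator estimates)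
qed

end
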